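(* Let $w(k)>0$ for all $k\in\mathbb{N}$ with $\sum_kw(k)=1$, let $\beta\in c_{\rm inc}$ with $\beta(-1)=0$, and let $\alpha:\mathbb{N}\to\mathbb{C}$ satisfy $\sum_{k\ge0}|\beta(k)-\alpha(k)|^2w(k)<\infty$. Suppose $\beta_\infty:=\lim_{k\to\infty}(\beta(k)-\beta(k-1))\neq0$. Then there is no closed operator $D_{\beta,\alpha,w}$ in $H_{\tau_w}$ with $$D_{\beta,\alpha,w}^{\min}\subset D_{\beta,\alpha,w}\subset D_{\beta,\alpha,w}^{\max}$$ such that $D_{\beta,\alpha,w}$ has compact parametrices.
   Context: $\mathbb{N}$ is the set of nonnegative integers, $\{E_k\}$ the canonical basis of $\ell^2(\mathbb{N})$, $U$ the unilateral shift $UE_k=E_{k+1}$; for a function $b$ on $\mathbb{N}$, $b(\mathbb{K})E_k=b(k)E_k$. $c_{\rm inc}$ is the set of $\beta:\mathbb{N}\to\mathbb{C}$, extended by $\beta(-1):=0$, such that $\{\beta(k)-\beta(k-1)\}_{k\ge0}$ converges. $H_{\tau_w}$ is the GNS Hilbert space of the faithful normal state $\tau_w(a)=\operatorname{tr}(w(\mathbb{K})a)$ on the Toeplitz algebra ($C^*$-algebra generated by $U$), identified with the space of formal series $f=\sum_{n\ge0}U^nf_n^+(\mathbb{K})+\sum_{n\ge1}f_n^-(\mathbb{K})(U^* )^n$, $f_n^\pm:\mathbb{N}\to\mathbb{C}$, with finite norm $$\|f\|^2=\sum_{n\ge0}\sum_{k\ge0}w(k)|f_n^+(k)|^2+\sum_{n\ge1}\sum_{k\ge0}w(k+n)|f_n^-(k)|^2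 .$$ Let $\mathcal{A}=\operatorname{Pol}(U,U^* )\subset H_{\tau_w}$, i.e. the finite sums $\sum_{n\ge0}U^nf_n^+(\mathbb{K})+\sum_{n\ge1}f_n^-(\mathbb{K})(U^* )^n$ with all $f_n^\pm$ eventually constant, and let $\mathcal{A}_0\subset\mathcal{A}$ be the finite sums $\sum_{n\ge0}U^nf_n^+(\mathbb{K})+\sum_{n\ge1}f_n^-(\mathbb{K})(U^* )^n$ with all $f_n^\pm$ of finite support (eventually zero). Consider the expression $$D_{\beta,\alpha,w}f=U\beta(\mathbb{K})f-fU\alpha(\mathbb{K}),$$ computed using $b(\mathbb{K})U=Ub(\mathbb{K}+1)$ and $U^*U=I$; explicitly $$D_{\beta,\alpha,w}f=\sum_{n\ge0}U^{n+1}(D_n^+f_n^+)(\mathbb{K})+\sum_{n\ge1}(D_n^-f_n^-)(\mathbb{K})(U^* )^{n-1},$$ $$(D_n^+g)(k)=\beta(k+n)g(k)-\alpha(k)g(k+1),\qquad (D_n^-g)(k)=\beta(k-1)g(k-1)-\alpha(k+n-1)g(k),$$ with $\beta(-1)g(-1)=0$. (This is an implementation in $H_{\tau_w}$ of the covariant derivation $a\mapsto[U\beta(\mathbb{K}),a]$.) $D_{\beta,\alpha,w}^{\max}$ is the closure of this operator defined on $\mathcal{A}$, and $D_{\beta,\alpha,w}^{\min}$ is the closure of this operator defined on $\mathcal{A}_0$. $S\subset T$ means that the operator $T$ extends $S$. A closed densely defined operator $D$ has compact parametrices if $(I+D^*D)^{-1/2}$ and $(I+DD^* )^{-1/2}$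 are compact. *)

theory Defs
  imports "HOL-Analysis.Analysis"
begin

section \<open>Operators in weighted \<open>\<ell>\<^sup>2\<close> spaces\<close>

definition wl2 :: "('i \<Rightarrow> real) \<Rightarrow> ('i \<Rightarrow> complex) set" where
  "wl2 \<mu> = {f. (\<lambda>i. \<mu> i * (cmod (f i))\<^sup>2) summable_on UNIV}"

definition wl2_inner :: "('i \<Rightarrow> real) \<Rightarrow> ('i \<Rightarrow> complex) \<Rightarrow> ('i \<Rightarrow> complex) \<Rightarrow> complex" where
  "wl2_inner \<mu> f g = (\<Sum>\<^sub>\<infinity>i. of_real (\<mu> i) * f i * cnj (g i))"

definition wl2_norm :: "('i \<Rightarrow> real) \<Rightarrow> ('i \<Rightarrow> complex) \<Rightarrow> real" where
  "wl2_norm \<mu> f = sqrt (\<Sum>\<^sub>\<infinity>i. \<mu> i * (cmod (f i))\<^sup>2)"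

definition wl2_tendsto ::
  "('i \<Rightarrow> real) \<Rightarrow> (nat \<Rightarrow> 'i \<Rightarrow> complex) \<Rightarrow> ('i \<Rightarrow> complex) \<Rightarrow> bool" where
  "wl2_tendsto \<mu> s f \<longleftrightarrow> range s \<subseteq> wl2 \<mu> \<and> f \<in> wl2 \<mu> \<and>
     (\<lambda>n. wl2_norm \<mu> (\<lambda>i. s n i - f i)) \<longlonglongrightarrow> 0"

text \<open>An operator (in general unbounded and not everywhere defined) is represented by its graph, so
  that \<open>S \<subseteq> T\<close> says that \<open>T\<close> extends \<open>S\<close>, and \<open>S O T\<close> is the product of operators usually written
  \<open>T S\<close>, with its natural domain.\<close>

type_synonym 'i graph = "(('i \<Rightarrow> complex) \<times> ('i \<Rightarrow> complex)) set"

definition linear_op :: "('i \<Rightarrow> real) \<Rightarrow> 'i graph \<Rightarrow> bool" where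
  "linear_op \<mu> T \<longleftrightarrow> T \<subseteq> wl2 \<mu> \<times> wl2 \<mu> \<and> single_valued T \<and>
     ((\<lambda>i. 0), (\<lambda>i. 0)) \<in> T \<and>
     (\<forall>f g f' g'. (f, g) \<in> T \<longrightarrow> (f', g') \<in> T \<longrightarrow> ((\<lambda>i. f i + f' i), (\<lambda>i. g i + g' i)) \<in> T) \<and>
     (\<forall>c f g. (f, g) \<in> T \<longrightarrow> ((\<lambda>i. c * f i), (\<lambda>i. c * g i)) \<in> T)"

definition op_closure :: "('i \<Rightarrow> real) \<Rightarrow> 'i graph \<Rightarrow> 'i graph" where
  "op_closure \<mu> T = {(f, g). \<exists>s t. (\<forall>n::nat. (s n, t n) \<in> T) \<and>
     wl2_tendsto \<mu> s f \<and> wl2_tendsto \<mu> t g}"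

definition closed_op :: "('i \<Rightarrow> real) \<Rightarrow> 'i graph \<Rightarrow> bool" where
  "closed_op \<mu> T \<longleftrightarrow> linear_op \<mu> T \<and> op_closure \<mu> T \<subseteq> T"

text \<open>The adjoint is the graph of an operator only when \<open>T\<close> is densely defined.\<close>

definition adjoint_op :: "('i \<Rightarrow> real) \<Rightarrow> 'i graph \<Rightarrow> 'i graph" where
  "adjoint_op \<mu> T = {(g, h). g \<in> wl2 \<mu> \<and> h \<in> wl2 \<mu> \<and>
     (\<forall>(u, v) \<in> T. wl2_inner \<mu> v g = wl2_inner \<mu> u h)}"

definition one_plus_op :: "'i graph \<Rightarrow> 'i graph" where
  "one_plus_op T = {(f, \<lambda>i. f i + g i) | f g. (f, g) \<in> T}"

definition bounded_op :: "('i \<Rightarrow> real) \<Rightarrow> 'i graph \<Rightarrow> bool" where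
  "bounded_op \<mu> T \<longleftrightarrow> linear_op \<mu> T \<and> Domain T = wl2 \<mu> \<and>
     (\<exists>C. \<forall>(f, g) \<in> T. wl2_norm \<mu> g \<le> C * wl2_norm \<mu> f)"

definition positive_op :: "('i \<Rightarrow> real) \<Rightarrow> 'i graph \<Rightarrow> bool" where
  "positive_op \<mu> T \<longleftrightarrow> (\<forall>(f, g) \<in> T. wl2_inner \<mu> g f \<in> \<real> \<and> 0 \<le> Re (wl2_inner \<mu> g f))"

definition compact_op :: "('i \<Rightarrow> real) \<Rightarrow> 'i graph \<Rightarrow> bool" where
  "compact_op \<mu> T \<longleftrightarrow> bounded_op \<mu> T \<and>
     (\<forall>s t. (\<forall>n::nat. (s n, t n) \<in> T \<and> wl2_norm \<mu> (s n) \<le> 1) \<longrightarrow>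
        (\<exists>r g. strict_mono r \<and> wl2_tendsto \<mu> (t \<circ> r) g))"

text \<open>\<open>R\<close> is the bounded operator \<open>A\<^sup>-\<^sup>1\<^sup>/\<^sup>2\<close>, i.e. the (unique) positive square root of the
  everywhere defined inverse of \<open>A\<close>; for \<open>A = I + D\<^sup>* D\<close> with \<open>D\<close> closed and densely defined it
  always exists.\<close>

definition is_inverse_sqrt :: "('i \<Rightarrow> real) \<Rightarrow> 'i graph \<Rightarrow> 'i graph \<Rightarrow> bool" where
  "is_inverse_sqrt \<mu> A R \<longleftrightarrow> bounded_op \<mu> R \<and> positive_op \<mu> R \<and> R O R = A\<inverse>"

definition has_compact_parametrices :: "('i \<Rightarrow> real) \<Rightarrow> 'i graph \<Rightarrow> bool" where
  "has_compact_parametrices \<mu> D \<longleftrightarrow>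
     (\<exists>R. is_inverse_sqrt \<mu> (one_plus_op (D O adjoint_op \<mu> D)) R \<and> compact_op \<mu> R) \<and>
     (\<exists>R. is_inverse_sqrt \<mu> (one_plus_op (adjoint_op \<mu> D O D)) R \<and> compact_op \<mu> R)"

section \<open>The GNS space of the Toeplitz algebra and the derivations\<close>

text \<open>A formal series \<open>\<Sum>\<^sub>n\<^sub>\<ge>\<^sub>0 U\<^sup>n f\<^sub>n\<^sup>+(K) + \<Sum>\<^sub>n\<^sub>\<ge>\<^sub>1 f\<^sub>n\<^sup>-(K) (U\<^sup>*)\<^sup>n\<close> is encoded as a function \<open>f\<close> on
  \<open>int \<times> nat\<close> with \<open>f (n, k) = f\<^sub>n\<^sup>+(k)\<close> for \<open>n \<ge> 0\<close> and \<open>f (- n, k) = f\<^sub>n\<^sup>-(k)\<close> for \<open>n \<ge> 1\<close>. With the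
  weight below, \<open>wl2 (gns_weight w)\<close> is the GNS Hilbert space of \<open>\<tau>\<^sub>w\<close>.\<close>

definition gns_weight :: "(nat \<Rightarrow> real) \<Rightarrow> int \<times> nat \<Rightarrow> real" where
  "gns_weight w = (\<lambda>(n, k). if 0 \<le> n then w k else w (k + nat (- n)))"

definition pol :: "(int \<times> nat \<Rightarrow> complex) set" where
  "pol = {f. finite {n. \<exists>k. f (n, k) \<noteq> 0} \<and> (\<forall>n. \<exists>c. \<forall>\<^sub>F k in sequentially. f (n, k) = c)}"

definition pol0 :: "(int \<times> nat \<Rightarrow> complex) set" where
  "pol0 = {f. finite {n. \<exists>k. f (n, k) \<noteq> 0} \<and> (\<forall>n. \<forall>\<^sub>F k in sequentially. f (n, k) = 0)}"

text \<open>\<open>prev b k\<close> is \<open>b (k - 1)\<close> with the convention \<open>b (- 1) = 0\<close>.\<close>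

definition prev :: "(nat \<Rightarrow> complex) \<Rightarrow> nat \<Rightarrow> complex" where
  "prev b k = (case k of 0 \<Rightarrow> 0 | Suc j \<Rightarrow> b j)"

definition increment :: "(nat \<Rightarrow> complex) \<Rightarrow> nat \<Rightarrow> complex" where
  "increment b k = b k - prev b k"

definition c_inc :: "(nat \<Rightarrow> complex) set" where
  "c_inc = {b. convergent (increment b)}"

definition D_plus ::
  "(nat \<Rightarrow> complex) \<Rightarrow> (nat \<Rightarrow> complex) \<Rightarrow> nat \<Rightarrow> (nat \<Rightarrow> complex) \<Rightarrow> nat \<Rightarrow> complex" where
  "D_plus \<beta> \<alpha> n g k = \<beta> (k + n) * g k - \<alpha> k * g (k + 1)"

text \<open>Only used for \<open>n \<ge> 1\<close>, where the truncated subtraction in \<open>k + n - 1\<close> is harmless.\<close>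

definition D_minus ::
  "(nat \<Rightarrow> complex) \<Rightarrow> (nat \<Rightarrow> complex) \<Rightarrow> nat \<Rightarrow> (nat \<Rightarrow> complex) \<Rightarrow> nat \<Rightarrow> complex" where
  "D_minus \<beta> \<alpha> n g k = prev \<beta> k * prev g k - \<alpha> (k + n - 1) * g k"

text \<open>The map \<open>f \<mapsto> U \<beta>(K) f - f U \<alpha>(K)\<close> raises the degree by one: \<open>U\<^sup>n f\<^sub>n\<^sup>+(K)\<close> goes to
  \<open>U\<^sup>n\<^sup>+\<^sup>1 (D\<^sub>n\<^sup>+ f\<^sub>n\<^sup>+)(K)\<close>, and \<open>f\<^sub>n\<^sup>-(K) (U\<^sup>*)\<^sup>n\<close> goes to \<open>(D\<^sub>n\<^sup>- f\<^sub>n\<^sup>-)(K) (U\<^sup>*)\<^sup>n\<^sup>-\<^sup>1\<close>. Hence the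
  component of degree \<open>m\<close> of the image comes from degree \<open>m - 1\<close>, that is from \<open>f\<^sub>n\<^sup>+\<close> with
  \<open>n = m - 1\<close> if \<open>m \<ge> 1\<close>, and from \<open>f\<^sub>n\<^sup>-\<close> with \<open>n = 1 - m\<close> if \<open>m \<le> 0\<close>.\<close>

definition D_expr ::
  "(nat \<Rightarrow> complex) \<Rightarrow> (nat \<Rightarrow> complex) \<Rightarrow> (int \<times> nat \<Rightarrow> complex) \<Rightarrow> int \<times> nat \<Rightarrow> complex" where
  "D_expr \<beta> \<alpha> f = (\<lambda>(m, k).
     if 1 \<le> m then D_plus \<beta> \<alpha> (nat (m - 1)) (\<lambda>j. f (m - 1, j)) k
     else D_minus \<beta> \<alpha> (nat (1 - m)) (\<lambda>j. f (m - 1, j)) k)"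

definition D_max ::
  "(nat \<Rightarrow> complex) \<Rightarrow> (nat \<Rightarrow> complex) \<Rightarrow> (nat \<Rightarrow> real) \<Rightarrow> (int \<times> nat) graph" where
  "D_max \<beta> \<alpha> w = op_closure (gns_weight w) {(f, D_expr \<beta> \<alpha> f) | f. f \<in> pol}"

definition D_min ::
  "(nat \<Rightarrow> complex) \<Rightarrow> (nat \<Rightarrow> complex) \<Rightarrow> (nat \<Rightarrow> real) \<Rightarrow> (int \<times> nat) graph" where
  "D_min \<beta> \<alpha> w = op_closure (gns_weight w) {(f, D_expr \<beta> \<alpha> f) | f. f \<in> pol0}"

end

theory Submission imports Defs
begin

text \<open>If \<open>D\<close> has compact parametrices, there is no sequence of unit vectors that is bounded in the graph
  norm of \<open>D\<close>, or in that of \<open>D\<^sup>*\<close>, and tends to zero in each coordinate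
  (\<open>no_compact_inverse_sqrt\<close>): such a sequence is weakly null, and compactness would make it tend
  to zero in norm. The proof produces such a sequence. Finitely supported vectors are available on
  both sides: they lie in the domain of \<open>D\<close> because \<open>D\<close> extends the minimal operator
  (\<open>domain_in_degree\<close>), and in the domain of \<open>D\<^sup>*\<close> because the maximal operator acts coordinatewise by
  the defining expression (\<open>adjoint_in_degree\<close>).

  The vectors are cut-offs of solutions of the two first-order recurrences
  \<open>\<alpha>(k) G(k+1) = \<beta>(k+p) G(k)\<close>, annihilated by \<open>D\<close> in degree \<open>p\<close>, and
  \<open>\<beta>(k) H(k+1) = \<alpha>(k+n-1) H(k)\<close>, where \<open>H(k) / w(k+n-1)\<close> is, up to conjugation, annihilated by
  \<open>D\<^sup>*\<close> in degree \<open>1-n\<close>. Each solution starts at an index beyond which the coefficient on the left has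
  no zeros; this costs one boundary term, whose size relative to the vector does not depend on the degree or on the cut-off.

  On the adjoint side the solution is cut off sharply at \<open>N\<close>, with boundary term of squared norm
  \<open>|\<alpha>(N+n-1) H(N)|\<^sup>2 / w(N+n)\<close>. If for each \<open>n\<close> this is at most \<open>1 / w(m+n-1)\<close> for some \<open>N\<close>, one
  vector from each degree gives the forbidden sequence. Otherwise some \<open>n\<close> satisfies
  \<open>w(N+n) < w(m+n-1) |\<alpha>(N+n-1) H(N)|\<^sup>2\<close> for all \<open>N \<ge> m\<close>
  (\<open>adjoint_solution_lower_bound\<close>); in particular \<open>\<alpha>\<close> has finitely many zeros and \<open>G\<close> exists. In the product
  \<open>G(N+n) \<alpha>(N+n-1) H(N)\<close> the factors \<open>\<alpha>\<close> cancel and those of \<open>\<beta>\<close> telescope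
  (\<open>recurrence_solution_product\<close>), so that it grows polynomially by the linear growth of \<open>\<beta>\<close>. Hence
  \<open>S\<^sub>p(N) = \<Sum>\<^sub>k\<^sub>\<le>\<^sub>N w(k) |G(k)|\<^sup>2\<close> grows polynomially for every \<open>p\<close>
  (\<open>solution_mass_polynomial_growth\<close>).

  Now \<open>G\<close> is multiplied by the tent \<open>max 0 (1 - k/2N)\<close>. Its slope \<open>1/2N\<close> compensates the linear growth
  of \<open>\<beta>\<close>, so the graph norm stays bounded, with a constant not depending on \<open>p\<close>, as long as \<open>S\<^sub>p(2N)\<close>
  is at most a fixed multiple of \<open>S\<^sub>p(N)\<close> (\<open>tent_vector\<close>). A positive monotone function of polynomial
  growth has this doubling property for arbitrarily large \<open>N\<close> (\<open>polynomial_growth_doubling\<close>). If some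
  \<open>S\<^sub>p\<close> is unbounded, the tents over growing \<open>N\<close> in that single degree tend to zero in each coordinate
  after normalisation. If all \<open>S\<^sub>p\<close> are bounded, the doubling constant is 2 for every \<open>p\<close>, and one tent
  from each degree does.\<close>

section \<open>Weighted square-summable functions\<close>

locale positive_weight =
  fixes \<mu> :: "'i \<Rightarrow> real"
  assumes weight_pos: "\<And>i. 0 < \<mu> i"
begin

lemma weight_nonneg: "0 \<le> \<mu> i"
  using weight_pos[of i] by simp

lemma wl2_summable:
  "f \<in> wl2 \<mu> \<Longrightarrow> (\<lambda>i. \<mu> i * (cmod (f i))\<^sup>2) summable_on UNIV"
  by (simp add: wl2_def)

lemma wl2_norm_nonneg: "0 \<le> wl2_norm \<mu> f"
  unfolding wl2_norm_def by (intro real_sqrt_ge_zero infsum_nonneg) (simp add: weight_nonneg)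

lemma wl2_norm_sq: "(wl2_norm \<mu> f)\<^sup>2 = (\<Sum>\<^sub>\<infinity>i. \<mu> i * (cmod (f i))\<^sup>2)"
  unfolding wl2_norm_def
  by (intro real_sqrt_pow2 infsum_nonneg) (simp add: weight_nonneg)

lemma wl2_finite_sum_le:
  assumes "f \<in> wl2 \<mu>" "finite F"
  shows "(\<Sum>i\<in>F. \<mu> i * (cmod (f i))\<^sup>2) \<le> (wl2_norm \<mu> f)\<^sup>2"
  unfolding wl2_norm_sq
  by (intro finite_sum_le_infsum) (use assms in \<open>auto simp: wl2_def weight_nonneg\<close>)

lemma wl2_add:
  assumes "f \<in> wl2 \<mu>" "g \<in> wl2 \<mu>"
  shows "(\<lambda>i. f i + g i) \<in> wl2 \<mu>"
proof -
  have "(\<lambda>i. 2 * (\<mu> i * (cmod (f i))\<^sup>2) + 2 * (\<mu> i * (cmod (g i))\<^sup>2)) summable_on UNIV"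
    by (intro summable_on_add summable_on_cmult_right wl2_summable assms)
  then have "(\<lambda>i. \<mu> i * (cmod (f i + g i))\<^sup>2) summable_on UNIV"
  proof (rule summable_on_comparison_test)
    fix i
    have "(cmod (f i + g i))\<^sup>2 \<le> (cmod (f i) + cmod (g i))\<^sup>2"
      by (intro power_mono norm_triangle_ineq) auto
    also have "\<dots> \<le> 2 * (cmod (f i))\<^sup>2 + 2 * (cmod (g i))\<^sup>2"
      using sum_squares_bound[of "cmod (f i)" "cmod (g i)"] by (simp add: power2_sum)
    finally have "\<mu> i * (cmod (f i + g i))\<^sup>2 \<le> \<mu> i * (2 * (cmod (f i))\<^sup>2 + 2 * (cmod (g i))\<^sup>2)"
      by (rule mult_left_mono) (rule weight_nonneg)
    then show "\<mu> i * (cmod (f i + g i))\<^sup>2 \<le> 2 * (\<mu> i * (cmod (f i))\<^sup>2) + 2 * (\<mu> i * (cmod (g i))\<^sup>2)"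
      by (simp add: algebra_simps)
  qed (simp add: weight_nonneg)
  then show ?thesis by (simp add: wl2_def)
qed

lemma wl2_scale:
  assumes "f \<in> wl2 \<mu>"
  shows "(\<lambda>i. c * f i) \<in> wl2 \<mu>" and "wl2_norm \<mu> (\<lambda>i. c * f i) = cmod c * wl2_norm \<mu> f"
proof -
  have eq: "(\<lambda>i. \<mu> i * (cmod (c * f i))\<^sup>2) = (\<lambda>i. (cmod c)\<^sup>2 * (\<mu> i * (cmod (f i))\<^sup>2))"
    by (simp add: norm_mult power_mult_distrib mult_ac)
  show "(\<lambda>i. c * f i) \<in> wl2 \<mu>"
    unfolding wl2_def mem_Collect_eq eq by (intro summable_on_cmult_right wl2_summable assms)
  show "wl2_norm \<mu> (\<lambda>i. c * f i) = cmod c * wl2_norm \<mu> f"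
    unfolding wl2_norm_def eq infsum_cmult_right' by (simp add: real_sqrt_mult)
qed

lemma wl2_diff:
  assumes "f \<in> wl2 \<mu>" "g \<in> wl2 \<mu>"
  shows "(\<lambda>i. f i - g i) \<in> wl2 \<mu>"
  using wl2_add[OF assms(1) wl2_scale(1)[OF assms(2), of "-1"]] by simp

lemma wl2_finite_support:
  assumes "finite F" "\<And>i. i \<notin> F \<Longrightarrow> f i = 0"
  shows "f \<in> wl2 \<mu>" and "(wl2_norm \<mu> f)\<^sup>2 = (\<Sum>i\<in>F. \<mu> i * (cmod (f i))\<^sup>2)"
proof -
  have "(\<lambda>i. \<mu> i * (cmod (f i))\<^sup>2) summable_on F"
    by (rule summable_on_finite) (rule assms)
  also have "?this \<longleftrightarrow> (\<lambda>i. \<mu> i * (cmod (f i))\<^sup>2) summable_on UNIV"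
    by (rule summable_on_cong_neutral) (use assms in auto)
  finally show "f \<in> wl2 \<mu>" by (simp add: wl2_def)
  have "(wl2_norm \<mu> f)\<^sup>2 = (\<Sum>\<^sub>\<infinity>i\<in>F. \<mu> i * (cmod (f i))\<^sup>2)"
    unfolding wl2_norm_sq by (rule infsum_cong_neutral) (use assms in auto)
  then show "(wl2_norm \<mu> f)\<^sup>2 = (\<Sum>i\<in>F. \<mu> i * (cmod (f i))\<^sup>2)"
    by (simp add: assms(1))
qed

lemma Cauchy_Schwarz_finite:
  assumes "f \<in> wl2 \<mu>" "g \<in> wl2 \<mu>" "finite F"
  shows "(\<Sum>i\<in>F. norm (of_real (\<mu> i) * f i * cnj (g i))) \<le> wl2_norm \<mu> f * wl2_norm \<mu> g"
proof -
  let ?v = "\<lambda>f i. sqrt (\<mu> i) * cmod (f i)"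
  have L2: "L2_set (?v f) F \<le> wl2_norm \<mu> f" if "f \<in> wl2 \<mu>" for f
  proof (rule power2_le_imp_le)
    have "(L2_set (?v f) F)\<^sup>2 = (\<Sum>i\<in>F. \<mu> i * (cmod (f i))\<^sup>2)"
      unfolding L2_set_def
      by (simp add: sum_nonneg power_mult_distrib weight_nonneg)
    then show "(L2_set (?v f) F)\<^sup>2 \<le> (wl2_norm \<mu> f)\<^sup>2"
      using wl2_finite_sum_le[OF that assms(3)] by simp
  qed (rule wl2_norm_nonneg)
  have "(\<Sum>i\<in>F. norm (of_real (\<mu> i) * f i * cnj (g i))) = (\<Sum>i\<in>F. \<bar>?v f i\<bar> * \<bar>?v g i\<bar>)"
  proof (rule sum.cong[OF refl])
    fix i
    have "\<mu> i = sqrt (\<mu> i) * sqrt (\<mu> i)" by (simp add: weight_nonneg)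
    then show "norm (of_real (\<mu> i) * f i * cnj (g i)) = \<bar>?v f i\<bar> * \<bar>?v g i\<bar>"
      by (simp add: norm_mult weight_nonneg abs_mult mult_ac flip: of_real_mult)
  qed
  also have "\<dots> \<le> L2_set (?v f) F * L2_set (?v g) F"
    by (rule L2_set_mult_ineq)
  also have "\<dots> \<le> wl2_norm \<mu> f * wl2_norm \<mu> g"
    by (intro mult_mono L2 assms wl2_norm_nonneg L2_set_nonneg)
  finally show ?thesis .
qed

lemma wl2_inner_summable:
  assumes "f \<in> wl2 \<mu>" "g \<in> wl2 \<mu>"
  shows "(\<lambda>i. norm (of_real (\<mu> i) * f i * cnj (g i))) summable_on UNIV"
    and "(\<lambda>i. of_real (\<mu> i) * f i * cnj (g i)) summable_on UNIV"
proof -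
  show *: "(\<lambda>i. norm (of_real (\<mu> i) * f i * cnj (g i))) summable_on UNIV"
    by (rule nonneg_bdd_above_summable_on)
      (auto intro!: bdd_aboveI2[where M = "wl2_norm \<mu> f * wl2_norm \<mu> g"]
          Cauchy_Schwarz_finite[OF assms])
  show "(\<lambda>i. of_real (\<mu> i) * f i * cnj (g i)) summable_on UNIV"
    by (rule abs_summable_summable[OF *])
qed

lemma Cauchy_Schwarz:
  assumes "f \<in> wl2 \<mu>" "g \<in> wl2 \<mu>"
  shows "cmod (wl2_inner \<mu> f g) \<le> wl2_norm \<mu> f * wl2_norm \<mu> g"
proof -
  have "cmod (wl2_inner \<mu> f g) \<le> (\<Sum>\<^sub>\<infinity>i. norm (of_real (\<mu> i) * f i * cnj (g i)))"
    unfolding wl2_inner_def by (rule norm_infsum_bound) (rule wl2_inner_summable[OF assms])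
  also have "\<dots> \<le> wl2_norm \<mu> f * wl2_norm \<mu> g"
    by (rule infsum_le_finite_sums[OF wl2_inner_summable(1)[OF assms]])
      (rule Cauchy_Schwarz_finite[OF assms])
  finally show ?thesis .
qed

lemma wl2_inner_add_right:
  assumes "f \<in> wl2 \<mu>" "g \<in> wl2 \<mu>" "h \<in> wl2 \<mu>"
  shows "wl2_inner \<mu> f (\<lambda>i. g i + h i) = wl2_inner \<mu> f g + wl2_inner \<mu> f h"
  unfolding wl2_inner_def
  by (simp add: ring_distribs infsum_add wl2_inner_summable assms)

lemma wl2_inner_diff_left:
  assumes "f \<in> wl2 \<mu>" "g \<in> wl2 \<mu>" "h \<in> wl2 \<mu>"
  shows "wl2_inner \<mu> (\<lambda>i. f i - g i) h = wl2_inner \<mu> f h - wl2_inner \<mu> g h"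
proof -
  have "wl2_inner \<mu> (\<lambda>i. f i - g i + g i) h = wl2_inner \<mu> (\<lambda>i. f i - g i) h + wl2_inner \<mu> g h"
    using wl2_inner_summable(2)[OF wl2_diff[OF assms(1,2)] assms(3)]
      wl2_inner_summable(2)[OF assms(2,3)]
    unfolding wl2_inner_def
    by (subst infsum_add[symmetric]) (auto intro!: infsum_cong simp: algebra_simps)
  then show ?thesis by simp
qed

lemma wl2_inner_commute: "wl2_inner \<mu> f g = cnj (wl2_inner \<mu> g f)"
  unfolding wl2_inner_def infsum_cnj[symmetric] by (simp add: mult_ac)

lemma wl2_inner_self:
  assumes "f \<in> wl2 \<mu>"
  shows "wl2_inner \<mu> f f = of_real ((wl2_norm \<mu> f)\<^sup>2)"
proof -
  have "wl2_inner \<mu> f f = (\<Sum>\<^sub>\<infinity>i. of_real (\<mu> i * (cmod (f i))\<^sup>2))"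
    unfolding wl2_inner_def
    by (simp add: mult.assoc complex_norm_square flip: of_real_power)
  also have "\<dots> = of_real (\<Sum>\<^sub>\<infinity>i. \<mu> i * (cmod (f i))\<^sup>2)"
    by (rule infsumI has_sum_of_real has_sum_infsum wl2_summable assms)+
  finally show ?thesis by (simp add: wl2_norm_sq)
qed

lemma wl2_inner_finite_support:
  assumes "finite F" "\<And>i. i \<notin> F \<Longrightarrow> f i * cnj (g i) = 0"
  shows "wl2_inner \<mu> f g = (\<Sum>i\<in>F. of_real (\<mu> i) * f i * cnj (g i))"
proof -
  have "wl2_inner \<mu> f g = (\<Sum>\<^sub>\<infinity>i\<in>F. of_real (\<mu> i) * f i * cnj (g i))"
    unfolding wl2_inner_def by (rule infsum_cong_neutral) (use assms in auto)
  then show ?thesis by (simp add: assms(1))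
qed

lemma wl2_coordinate_le:
  assumes "f \<in> wl2 \<mu>"
  shows "cmod (f i) \<le> wl2_norm \<mu> f / sqrt (\<mu> i)"
proof -
  have "\<mu> i * (cmod (f i))\<^sup>2 \<le> (wl2_norm \<mu> f)\<^sup>2"
    using wl2_finite_sum_le[OF assms, of "{i}"] by simp
  then have "sqrt (\<mu> i * (cmod (f i))\<^sup>2) \<le> wl2_norm \<mu> f"
    using real_le_lsqrt wl2_norm_nonneg by blast
  then show ?thesis
    using weight_pos[of i] by (simp add: real_sqrt_mult field_simps)
qed

lemma wl2_tendsto_coordinate:
  assumes "wl2_tendsto \<mu> s f"
  shows "(\<lambda>n. s n i) \<longlonglongrightarrow> f i"
proof -
  have s: "s n \<in> wl2 \<mu>" and f: "f \<in> wl2 \<mu>"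
    and lim: "(\<lambda>n. wl2_norm \<mu> (\<lambda>i. s n i - f i)) \<longlonglongrightarrow> 0" for n
    using assms by (auto simp: wl2_tendsto_def)
  have "(\<lambda>n. s n i - f i) \<longlonglongrightarrow> 0"
  proof (rule Lim_null_comparison)
    show "\<forall>\<^sub>F n in sequentially. norm (s n i - f i) \<le> wl2_norm \<mu> (\<lambda>i. s n i - f i) / sqrt (\<mu> i)"
      using wl2_coordinate_le[OF wl2_diff[OF s f]] by simp
    show "(\<lambda>n. wl2_norm \<mu> (\<lambda>i. s n i - f i) / sqrt (\<mu> i)) \<longlonglongrightarrow> 0"
      using tendsto_divide_zero[OF lim] by simp
  qed
  then show ?thesis by (rule LIM_zero_cancel)
qed

text \<open>Split the test vector into a finite part, on which coordinatewise convergence suffices, and a tail of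
  small norm, on which the norm bound suffices.\<close>

lemma weakly_null_of_pointwise_null:
  assumes f: "\<And>n. f n \<in> wl2 \<mu>" "\<And>n. wl2_norm \<mu> (f n) \<le> 1"
    and null: "\<And>i. (\<lambda>n. f n i) \<longlonglongrightarrow> 0" and x: "x \<in> wl2 \<mu>"
  shows "(\<lambda>n. wl2_inner \<mu> (f n) x) \<longlonglongrightarrow> 0"
proof (rule LIMSEQ_I)
  fix \<epsilon> :: real assume \<epsilon>: "0 < \<epsilon>"
  let ?X = "\<lambda>i. \<mu> i * (cmod (x i))\<^sup>2"
  have "((\<lambda>F. sum ?X F) \<longlongrightarrow> (wl2_norm \<mu> x)\<^sup>2) (finite_subsets_at_top UNIV)"
    unfolding wl2_norm_sq using has_sum_infsum[OF wl2_summable[OF x]] by (simp add: has_sum_def)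
  then have "\<forall>\<^sub>F F in finite_subsets_at_top UNIV. dist (sum ?X F) ((wl2_norm \<mu> x)\<^sup>2) < (\<epsilon> / 2)\<^sup>2"
    by (rule tendstoD) (use \<epsilon> in simp)
  then obtain F where F: "finite F" "dist (sum ?X F) ((wl2_norm \<mu> x)\<^sup>2) < (\<epsilon> / 2)\<^sup>2"
    unfolding eventually_finite_subsets_at_top by blast
  \<comment> \<open>\<open>F\<close> carries all of \<open>x\<close> except a part of norm less than \<open>\<epsilon> / 2\<close>.\<close>
  define x1 where "x1 = (\<lambda>i. if i \<in> F then x i else 0)"
  define x2 where "x2 = (\<lambda>i. if i \<in> F then 0 else x i)"
  have x1: "x1 \<in> wl2 \<mu>" "(wl2_norm \<mu> x1)\<^sup>2 = sum ?X F"
    using wl2_finite_support[of F x1] F(1) by (auto simp: x1_def)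
  have x2: "x2 \<in> wl2 \<mu>"
    using wl2_diff[OF x x1(1)] by (rule back_subst[of "\<lambda>y. y \<in> wl2 \<mu>"]) (auto simp: x1_def x2_def)
  have split: "(\<lambda>i. x1 i + x2 i) = x" by (auto simp: x1_def x2_def)
  have "(wl2_norm \<mu> x)\<^sup>2 = (wl2_norm \<mu> x1)\<^sup>2 + (wl2_norm \<mu> x2)\<^sup>2"
    unfolding wl2_norm_sq infsum_add[OF wl2_summable[OF x1(1)] wl2_summable[OF x2], symmetric]
    by (intro infsum_cong) (simp add: x1_def x2_def)
  then have "(wl2_norm \<mu> x2)\<^sup>2 < (\<epsilon> / 2)\<^sup>2"
    using F(2) x1(2) by (auto simp: dist_real_def)
  then have x2_small: "wl2_norm \<mu> x2 < \<epsilon> / 2"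
    using \<epsilon> power2_less_imp_less by fastforce
  have "(\<lambda>n. \<Sum>i\<in>F. of_real (\<mu> i) * f n i * cnj (x1 i))
      \<longlonglongrightarrow> (\<Sum>i\<in>F. of_real (\<mu> i) * 0 * cnj (x1 i))"
    by (intro tendsto_sum tendsto_mult tendsto_const null)
  moreover have "wl2_inner \<mu> (f n) x1 = (\<Sum>i\<in>F. of_real (\<mu> i) * f n i * cnj (x1 i))" for n
    by (rule wl2_inner_finite_support[OF F(1)]) (simp add: x1_def)
  ultimately have "(\<lambda>n. wl2_inner \<mu> (f n) x1) \<longlonglongrightarrow> 0" by simp
  from LIMSEQ_D[OF this, of "\<epsilon> / 2"] obtain N where
    N: "\<And>n. n \<ge> N \<Longrightarrow> norm (wl2_inner \<mu> (f n) x1) < \<epsilon> / 2" using \<epsilon> by auto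
  have "norm (wl2_inner \<mu> (f n) x - 0) < \<epsilon>" if "n \<ge> N" for n
  proof -
    have "wl2_inner \<mu> (f n) x = wl2_inner \<mu> (f n) x1 + wl2_inner \<mu> (f n) x2"
      using wl2_inner_add_right[OF f(1) x1(1) x2] by (simp add: split)
    then have "norm (wl2_inner \<mu> (f n) x) \<le> norm (wl2_inner \<mu> (f n) x1) + norm (wl2_inner \<mu> (f n) x2)"
      by (simp add: norm_triangle_ineq)
    moreover have "norm (wl2_inner \<mu> (f n) x2) \<le> 1 * wl2_norm \<mu> x2"
      using Cauchy_Schwarz[OF f(1) x2] mult_right_mono[OF f(2) wl2_norm_nonneg] order_trans by blast
    ultimately show ?thesis using N[OF that] x2_small by simp
  qed
  then show "\<exists>N. \<forall>n\<ge>N. norm (wl2_inner \<mu> (f n) x - 0) < \<epsilon>" by blast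
qed

section \<open>Compactness of the inverse square root\<close>

text \<open>With \<open>T\<close> formally adjoint to \<open>S\<close>, this says that \<open>y = (I + T S)\<^sup>-\<^sup>1 x\<close> represents the functional
  \<open>f \<mapsto> \<langle>f, x\<rangle>\<close> with respect to the inner product of the graph of \<open>S\<close>. Since only the pairing of \<open>S\<close> and
  \<open>T\<close> enters, it serves both for \<open>(S, T) = (D, D\<^sup>*)\<close> and for \<open>(S, T) = (D\<^sup>*, D)\<close>.\<close>

lemma resolvent_identity:
  assumes S: "S \<subseteq> wl2 \<mu> \<times> wl2 \<mu>" and T: "T \<subseteq> wl2 \<mu> \<times> wl2 \<mu>"
    and pairing: "\<And>u v g h. (u, v) \<in> S \<Longrightarrow> (g, h) \<in> T \<Longrightarrow> wl2_inner \<mu> v g = wl2_inner \<mu> u h"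
    and yx: "(y, x) \<in> one_plus_op (S O T)"
  obtains q where "(y, q) \<in> S"
    "\<And>f d. (f, d) \<in> S \<Longrightarrow> wl2_inner \<mu> f x = wl2_inner \<mu> f y + wl2_inner \<mu> d q"
proof -
  from yx obtain q z where q: "(y, q) \<in> S" "(q, z) \<in> T" and x: "x = (\<lambda>i. y i + z i)"
    unfolding one_plus_op_def by auto
  have "wl2_inner \<mu> f x = wl2_inner \<mu> f y + wl2_inner \<mu> d q" if "(f, d) \<in> S" for f d
    using pairing[OF that q(2)] wl2_inner_add_right[of f y z] S T that q unfolding x by auto
  with q(1) show ?thesis using that by blast
qed

text \<open>Let \<open>y\<^sub>n\<close> be the image of \<open>f\<^sub>n\<close> under \<open>R\<^sup>2 = (I + T S)\<^sup>-\<^sup>1\<close>. By compactness a subsequence of \<open>y\<^sub>n\<close>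
  converges in norm, and its limit is zero because \<open>R\<^sup>2\<close> is symmetric and \<open>f\<^sub>n\<close> is weakly null. But in
  the graph norm of \<open>S\<close> the pairing of \<open>f\<^sub>n\<close> with \<open>y\<^sub>n\<close> is \<open>\<parallel>f\<^sub>n\<parallel>\<^sup>2 = 1\<close>, while the squared graph norm
  of \<open>y\<^sub>n\<close> is at most \<open>\<parallel>y\<^sub>n\<parallel>\<close>: with \<open>f\<^sub>n\<close> bounded in graph norm this is impossible.\<close>

lemma no_compact_inverse_sqrt:
  assumes S: "S \<subseteq> wl2 \<mu> \<times> wl2 \<mu>" and T: "T \<subseteq> wl2 \<mu> \<times> wl2 \<mu>"
    and pairing: "\<And>u v g h. (u, v) \<in> S \<Longrightarrow> (g, h) \<in> T \<Longrightarrow> wl2_inner \<mu> v g = wl2_inner \<mu> u h"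
    and f: "\<And>n. (f n, d n) \<in> S" "\<And>n. wl2_norm \<mu> (f n) = 1" "\<And>n. wl2_norm \<mu> (d n) \<le> C"
    and null: "\<And>i. (\<lambda>n. f n i) \<longlonglongrightarrow> 0"
    and R: "is_inverse_sqrt \<mu> (one_plus_op (S O T)) R"
  shows "\<not> compact_op \<mu> R"
proof
  assume compact: "compact_op \<mu> R"
  have lin: "linear_op \<mu> R" and dom: "Domain R = wl2 \<mu>" and RR: "R O R = (one_plus_op (S O T))\<inverse>"
    using R by (auto simp: is_inverse_sqrt_def bounded_op_def)
  obtain K where K: "\<And>a b. (a, b) \<in> R \<Longrightarrow> wl2_norm \<mu> b \<le> K * wl2_norm \<mu> a"
    using R unfolding is_inverse_sqrt_def bounded_op_def by fast
  have R_wl2: "a \<in> wl2 \<mu>" "b \<in> wl2 \<mu>" if "(a, b) \<in> R" for a b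
    using lin that by (auto simp: linear_op_def)
  have R_diff: "((\<lambda>i. a i - a' i), (\<lambda>i. b i - b' i)) \<in> R" if "(a, b) \<in> R" "(a', b') \<in> R" for a b a' b'
  proof -
    have "((\<lambda>i. (-1) * a' i), (\<lambda>i. (-1) * b' i)) \<in> R"
      using lin that unfolding linear_op_def by blast
    with lin that(1) have "((\<lambda>i. a i + (-1) * a' i), (\<lambda>i. b i + (-1) * b' i)) \<in> R"
      unfolding linear_op_def by blast
    then show ?thesis by simp
  qed
  have f_wl2: "f n \<in> wl2 \<mu>" for n using f(1) S by auto
  have "\<exists>t. (f n, t) \<in> R" for n using dom f_wl2 by auto
  then obtain t where t: "\<And>n. (f n, t n) \<in> R" by metis
  have "\<exists>y. (t n, y) \<in> R" for n using dom R_wl2(2)[OF t[of n]] by auto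
  then obtain y where y: "\<And>n. (t n, y n) \<in> R" by metis
  from compact t f(2) obtain r g where r: "strict_mono r" and rg: "wl2_tendsto \<mu> (t \<circ> r) g"
    unfolding compact_op_def by (metis order_refl)
  obtain y' where y': "(g, y') \<in> R" using rg dom unfolding wl2_tendsto_def by blast
  have y_wl2: "y n \<in> wl2 \<mu>" "y' \<in> wl2 \<mu>" for n
    using R_wl2(2)[OF y[of n]] R_wl2(2)[OF y'] by auto
  \<comment> \<open>The images of the chosen vectors under the inverse converge along the subsequence.\<close>
  have lim: "(\<lambda>n. wl2_norm \<mu> (\<lambda>i. y (r n) i - y' i)) \<longlonglongrightarrow> 0"
  proof (rule tendsto_sandwich)
    show "\<forall>\<^sub>F n in sequentially. 0 \<le> wl2_norm \<mu> (\<lambda>i. y (r n) i - y' i)"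
      by (simp add: wl2_norm_nonneg)
    show "\<forall>\<^sub>F n in sequentially.
        wl2_norm \<mu> (\<lambda>i. y (r n) i - y' i) \<le> K * wl2_norm \<mu> (\<lambda>i. (t \<circ> r) n i - g i)"
      using K[OF R_diff[OF y y']] by simp
    show "(\<lambda>n. K * wl2_norm \<mu> (\<lambda>i. (t \<circ> r) n i - g i)) \<longlonglongrightarrow> 0"
      using rg unfolding wl2_tendsto_def by (auto intro: tendsto_mult_right_zero)
  qed simp
  have inverse: "(b, a) \<in> one_plus_op (S O T)" if "(a, c) \<in> R" "(c, b) \<in> R" for a b c
    using RR that by blast
  note res = resolvent_identity[OF S T pairing inverse]
  have symmetric: "wl2_inner \<mu> b a' = wl2_inner \<mu> a b'"
    if R: "(a, c) \<in> R" "(c, b) \<in> R" and R': "(a', c') \<in> R" "(c', b') \<in> R" for a b c a' b' c'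
  proof -
    obtain q where q: "(b, q) \<in> S"
      "\<And>f d. (f, d) \<in> S \<Longrightarrow> wl2_inner \<mu> f a = wl2_inner \<mu> f b + wl2_inner \<mu> d q"
      using res[OF _ _ R] by blast
    obtain q' where q': "(b', q') \<in> S"
      "\<And>f d. (f, d) \<in> S \<Longrightarrow> wl2_inner \<mu> f a' = wl2_inner \<mu> f b' + wl2_inner \<mu> d q'"
      using res[OF _ _ R'] by blast
    have "wl2_inner \<mu> b a' = wl2_inner \<mu> b b' + wl2_inner \<mu> q q'" by (rule q'(2)[OF q(1)])
    also have "\<dots> = cnj (wl2_inner \<mu> b' b + wl2_inner \<mu> q' q)"
      using wl2_inner_commute by (metis complex_cnj_add)
    also have "\<dots> = cnj (wl2_inner \<mu> b' a)" using q(2)[OF q'(1)] by simp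
    finally show ?thesis using wl2_inner_commute[of a b'] by simp
  qed
  \<comment> \<open>The inverse is symmetric and the vectors are weakly null, so the strong limit vanishes.\<close>
  have "(\<lambda>n. wl2_inner \<mu> (y (r n)) y') \<longlonglongrightarrow> 0"
  proof -
    obtain c where c: "(y', c) \<in> R" using dom y_wl2(2) by auto
    obtain b where b: "(c, b) \<in> R" using dom R_wl2(2)[OF c] by auto
    have "(\<lambda>n. wl2_inner \<mu> (f n) b) \<longlonglongrightarrow> 0"
      by (rule weakly_null_of_pointwise_null) (use f_wl2 f(2) null R_wl2 b in auto)
    then have "(\<lambda>n. wl2_inner \<mu> (f (r n)) b) \<longlonglongrightarrow> 0"
      using LIMSEQ_subseq_LIMSEQ[OF _ r] unfolding o_def by blast
    then show ?thesis using symmetric[OF t y c b] by simp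
  qed
  moreover have "(\<lambda>n. wl2_inner \<mu> (y (r n)) y' - wl2_inner \<mu> y' y') \<longlonglongrightarrow> 0"
  proof (rule Lim_null_comparison)
    show "\<forall>\<^sub>F n in sequentially. norm (wl2_inner \<mu> (y (r n)) y' - wl2_inner \<mu> y' y')
        \<le> wl2_norm \<mu> (\<lambda>i. y (r n) i - y' i) * wl2_norm \<mu> y'"
      using Cauchy_Schwarz[OF wl2_diff[OF y_wl2] y_wl2(2)]
      by (simp add: wl2_inner_diff_left y_wl2)
    show "(\<lambda>n. wl2_norm \<mu> (\<lambda>i. y (r n) i - y' i) * wl2_norm \<mu> y') \<longlonglongrightarrow> 0"
      using tendsto_mult_left_zero[OF lim] .
  qed
  ultimately have "(\<lambda>n. - wl2_inner \<mu> y' y') \<longlonglongrightarrow> 0 - 0"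
    using tendsto_diff by fastforce
  then have "wl2_inner \<mu> y' y' = 0" using LIMSEQ_unique tendsto_const by fastforce
  then have "wl2_norm \<mu> y' = 0" using wl2_inner_self[OF y_wl2(2)] by simp
  then have "y' i = 0" for i using wl2_coordinate_le[OF y_wl2(2), of i] by simp
  then have lim0: "(\<lambda>n. wl2_norm \<mu> (y (r n))) \<longlonglongrightarrow> 0" using lim by simp
  \<comment> \<open>Hence the vectors themselves converge to zero in norm, against their normalisation.\<close>
  have bound: "1 \<le> wl2_norm \<mu> (y n) + C * sqrt (wl2_norm \<mu> (y n))" for n
  proof -
    obtain q where q: "(y n, q) \<in> S"
      "\<And>g h. (g, h) \<in> S \<Longrightarrow> wl2_inner \<mu> g (f n) = wl2_inner \<mu> g (y n) + wl2_inner \<mu> h q"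
      using res[OF _ _ t y] by blast
    have wl2: "q \<in> wl2 \<mu>" "d n \<in> wl2 \<mu>" using q(1) f(1)[of n] S by auto
    have "of_real ((wl2_norm \<mu> (y n))\<^sup>2 + (wl2_norm \<mu> q)\<^sup>2) = wl2_inner \<mu> (y n) (f n)"
      using q(2)[OF q(1)] by (simp add: wl2_inner_self wl2 y_wl2)
    then have "\<bar>(wl2_norm \<mu> (y n))\<^sup>2 + (wl2_norm \<mu> q)\<^sup>2\<bar> \<le> wl2_norm \<mu> (y n)"
      using Cauchy_Schwarz[OF y_wl2(1) f_wl2, of n n] f(2) by (metis mult.right_neutral norm_of_real)
    then have "(wl2_norm \<mu> q)\<^sup>2 \<le> wl2_norm \<mu> (y n)"
      using zero_le_power2[of "wl2_norm \<mu> (y n)"] by linarith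
    then have q_le: "wl2_norm \<mu> q \<le> sqrt (wl2_norm \<mu> (y n))"
      by (rule real_le_rsqrt)
    have "of_real 1 = wl2_inner \<mu> (f n) (y n) + wl2_inner \<mu> (d n) q"
      using q(2)[OF f(1)[of n]] f(2)[of n] by (simp add: wl2_inner_self f_wl2)
    then have "1 \<le> cmod (wl2_inner \<mu> (f n) (y n)) + cmod (wl2_inner \<mu> (d n) q)"
      by (metis norm_of_real abs_one norm_triangle_ineq)
    also have "\<dots> \<le> 1 * wl2_norm \<mu> (y n) + wl2_norm \<mu> (d n) * wl2_norm \<mu> q"
      using Cauchy_Schwarz[OF f_wl2[of n] y_wl2(1)[of n]] Cauchy_Schwarz[OF wl2(2,1)] f(2)[of n]
      by simp
    also have "\<dots> \<le> wl2_norm \<mu> (y n) + C * sqrt (wl2_norm \<mu> (y n))"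
      using mult_mono[OF f(3) q_le] wl2_norm_nonneg order_trans[OF wl2_norm_nonneg f(3)] by simp
    finally show ?thesis .
  qed
  have "(\<lambda>n. wl2_norm \<mu> (y (r n)) + C * sqrt (wl2_norm \<mu> (y (r n)))) \<longlonglongrightarrow> 0 + C * sqrt 0"
    by (intro tendsto_intros lim0)
  then have "1 \<le> 0 + C * sqrt 0"
    by (rule LIMSEQ_le_const) (use bound in auto)
  then show False by simp
qed


lemma no_compact_inverse_sqrt_unnormalised:
  assumes S: "S \<subseteq> wl2 \<mu> \<times> wl2 \<mu>" and T: "T \<subseteq> wl2 \<mu> \<times> wl2 \<mu>"
    and pairing: "\<And>u v g h. (u, v) \<in> S \<Longrightarrow> (g, h) \<in> T \<Longrightarrow> wl2_inner \<mu> v g = wl2_inner \<mu> u h"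
    and scale: "\<And>c u v. (u, v) \<in> S \<Longrightarrow> ((\<lambda>i. c * u i), (\<lambda>i. c * v i)) \<in> S"
    and f: "\<And>n. (f n, d n) \<in> S" "\<And>n. 0 < wl2_norm \<mu> (f n)"
      "\<And>n. (wl2_norm \<mu> (d n))\<^sup>2 \<le> C * (wl2_norm \<mu> (f n))\<^sup>2"
    and null: "\<And>i. (\<lambda>n. f n i / of_real (wl2_norm \<mu> (f n))) \<longlonglongrightarrow> 0"
    and R: "is_inverse_sqrt \<mu> (one_plus_op (S O T)) R"
  shows "\<not> compact_op \<mu> R"
proof -
  define c where "c n = complex_of_real (inverse (wl2_norm \<mu> (f n)))" for n
  have c: "cmod (c n) = inverse (wl2_norm \<mu> (f n))" for n
    using f(2)[of n] by (simp add: c_def norm_inverse)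
  have wl2: "f n \<in> wl2 \<mu>" "d n \<in> wl2 \<mu>" for n using f(1)[of n] S by auto
  show ?thesis
  proof (rule no_compact_inverse_sqrt[OF S T pairing _ _ _ _ R])
    show "((\<lambda>i. c n * f n i), (\<lambda>i. c n * d n i)) \<in> S" for n by (rule scale[OF f(1)])
    show "wl2_norm \<mu> (\<lambda>i. c n * f n i) = 1" for n
      using f(2)[of n] by (simp add: wl2_scale(2)[OF wl2(1)] c)
    show "wl2_norm \<mu> (\<lambda>i. c n * d n i) \<le> sqrt C" for n
    proof (rule real_le_rsqrt)
      have "(wl2_norm \<mu> (\<lambda>i. c n * d n i))\<^sup>2 = (wl2_norm \<mu> (d n))\<^sup>2 / (wl2_norm \<mu> (f n))\<^sup>2"
        by (simp add: wl2_scale(2)[OF wl2(2)] c power_mult_distrib field_simps)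
      also have "\<dots> \<le> C" using f(2,3)[of n] by (simp add: pos_divide_le_eq)
      finally show "(wl2_norm \<mu> (\<lambda>i. c n * d n i))\<^sup>2 \<le> C" .
    qed
    show "(\<lambda>n. c n * f n i) \<longlonglongrightarrow> 0" for i
      using null[of i] by (simp add: c_def divide_inverse mult.commute)
  qed
qed

lemma wl2_inner_scale_right: "wl2_inner \<mu> f (\<lambda>i. c * g i) = cnj c * wl2_inner \<mu> f g"
  unfolding wl2_inner_def infsum_cmult_right'[symmetric] by (simp add: mult_ac)

lemma compact_parametrices_domain:
  assumes D: "linear_op \<mu> D" "has_compact_parametrices \<mu> D"
    and f: "\<And>n. (f n, d n) \<in> D" "\<And>n. 0 < wl2_norm \<mu> (f n)"
      "\<And>n. (wl2_norm \<mu> (d n))\<^sup>2 \<le> C * (wl2_norm \<mu> (f n))\<^sup>2"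
  shows "\<not> (\<forall>i. (\<lambda>n. f n i / of_real (wl2_norm \<mu> (f n))) \<longlonglongrightarrow> 0)"
proof
  assume null: "\<forall>i. (\<lambda>n. f n i / of_real (wl2_norm \<mu> (f n))) \<longlonglongrightarrow> 0"
  obtain R where R: "is_inverse_sqrt \<mu> (one_plus_op (D O adjoint_op \<mu> D)) R" "compact_op \<mu> R"
    using D(2) unfolding has_compact_parametrices_def by blast
  have "\<not> compact_op \<mu> R"
  proof (rule no_compact_inverse_sqrt_unnormalised[OF _ _ _ _ f _ R(1)])
    show "D \<subseteq> wl2 \<mu> \<times> wl2 \<mu>" "adjoint_op \<mu> D \<subseteq> wl2 \<mu> \<times> wl2 \<mu>"
      using D(1) by (auto simp: linear_op_def adjoint_op_def)
    show "wl2_inner \<mu> v g = wl2_inner \<mu> u h" if "(u, v) \<in> D" "(g, h) \<in> adjoint_op \<mu> D" for u v g h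
      using that by (auto simp: adjoint_op_def)
    show "((\<lambda>i. c * u i), (\<lambda>i. c * v i)) \<in> D" if "(u, v) \<in> D" for c u v
      using that D(1) by (auto simp: linear_op_def)
  qed (use null in auto)
  with R(2) show False by simp
qed

lemma compact_parametrices_adjoint:
  assumes D: "linear_op \<mu> D" "has_compact_parametrices \<mu> D"
    and f: "\<And>n. (f n, d n) \<in> adjoint_op \<mu> D" "\<And>n. 0 < wl2_norm \<mu> (f n)"
      "\<And>n. (wl2_norm \<mu> (d n))\<^sup>2 \<le> C * (wl2_norm \<mu> (f n))\<^sup>2"
  shows "\<not> (\<forall>i. (\<lambda>n. f n i / of_real (wl2_norm \<mu> (f n))) \<longlonglongrightarrow> 0)"
proof
  assume null: "\<forall>i. (\<lambda>n. f n i / of_real (wl2_norm \<mu> (f n))) \<longlonglongrightarrow> 0"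
  obtain R where R: "is_inverse_sqrt \<mu> (one_plus_op (adjoint_op \<mu> D O D)) R" "compact_op \<mu> R"
    using D(2) unfolding has_compact_parametrices_def by blast
  have "\<not> compact_op \<mu> R"
  proof (rule no_compact_inverse_sqrt_unnormalised[OF _ _ _ _ f _ R(1)])
    show "D \<subseteq> wl2 \<mu> \<times> wl2 \<mu>" "adjoint_op \<mu> D \<subseteq> wl2 \<mu> \<times> wl2 \<mu>"
      using D(1) by (auto simp: linear_op_def adjoint_op_def)
    show "wl2_inner \<mu> h u = wl2_inner \<mu> g v" if "(g, h) \<in> adjoint_op \<mu> D" "(u, v) \<in> D" for u v g h
    proof -
      have "wl2_inner \<mu> v g = wl2_inner \<mu> u h" using that by (auto simp: adjoint_op_def)
      then show ?thesis using wl2_inner_commute by metis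
    qed
    show "((\<lambda>i. c * u i), (\<lambda>i. c * v i)) \<in> adjoint_op \<mu> D" if "(u, v) \<in> adjoint_op \<mu> D" for c u v
      using that by (auto simp: adjoint_op_def wl2_scale(1) wl2_inner_scale_right)
  qed (use null in auto)
  with R(2) show False by simp
qed

end

section \<open>Growth of sequences\<close>

lemma c_inc_linear_growth:
  assumes "\<beta> \<in> c_inc"
  obtains L where "0 \<le> L" "\<And>k. cmod (\<beta> k) \<le> L * real (k + 1)"
proof -
  have "Bseq (increment \<beta>)" using assms by (auto simp: c_inc_def intro: convergent_imp_Bseq)
  then obtain L where L: "0 < L" "\<And>k. cmod (increment \<beta> k) \<le> L" by (auto elim: BseqE)
  have "cmod (\<beta> k) \<le> L * real (k + 1)" for k
  proof (induction k)
    case 0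
    then show ?case using L(2)[of 0] by (simp add: increment_def prev_def)
  next
    case (Suc k)
    have "\<beta> (Suc k) = increment \<beta> (Suc k) + \<beta> k" by (simp add: increment_def prev_def)
    then have "cmod (\<beta> (Suc k)) \<le> cmod (increment \<beta> (Suc k)) + cmod (\<beta> k)"
      by (simp add: norm_triangle_ineq)
    then show ?case using Suc L(2)[of "Suc k"] by (simp add: algebra_simps)
  qed
  with L(1) show ?thesis by (intro that[of L]) auto
qed

text \<open>Beyond a suitable index \<open>J\<close> the sequence deviates from the line \<open>\<beta>(J) + (k - J) b\<close>, where \<open>b\<close> is the
  limit of the increments, by at most \<open>(k - J) |b| / 2\<close>.\<close>

lemma c_inc_eventually_nonzero:
  assumes "\<beta> \<in> c_inc" "lim (increment \<beta>) \<noteq> 0"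
  obtains m where "1 \<le> m" "\<And>k. m \<le> k \<Longrightarrow> \<beta> k \<noteq> 0"
proof -
  define b where "b = lim (increment \<beta>)"
  have b: "0 < cmod b" using assms(2) by (simp add: b_def)
  have "increment \<beta> \<longlonglongrightarrow> b"
    using assms(1) by (simp add: c_inc_def b_def convergent_LIMSEQ_iff)
  then obtain J where J: "\<And>k. k \<ge> J \<Longrightarrow> cmod (increment \<beta> k - b) < cmod b / 2"
    using LIMSEQ_D[of "increment \<beta>" b "cmod b / 2"] b by auto
  have dev: "cmod (\<beta> (J + i) - \<beta> J - of_nat i * b) \<le> real i * (cmod b / 2)" for i
  proof (induction i)
    case (Suc i)
    have "\<beta> (J + Suc i) - \<beta> J - of_nat (Suc i) * b
        = (\<beta> (J + i) - \<beta> J - of_nat i * b) + (increment \<beta> (J + Suc i) - b)"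
      by (simp add: increment_def prev_def algebra_simps)
    then have "cmod (\<beta> (J + Suc i) - \<beta> J - of_nat (Suc i) * b)
        \<le> cmod (\<beta> (J + i) - \<beta> J - of_nat i * b) + cmod (increment \<beta> (J + Suc i) - b)"
      by (metis norm_triangle_ineq)
    then show ?case using Suc J[of "J + Suc i"] by (simp add: algebra_simps)
  qed simp
  obtain i0 :: nat where i0: "cmod (\<beta> J) / (cmod b / 2) < real i0"
    using reals_Archimedean2 by blast
  have "\<beta> k \<noteq> 0" if "J + i0 + 1 \<le> k" for k
  proof
    assume "\<beta> k = 0"
    define i where "i = k - J"
    have k: "k = J + i" and i: "i0 \<le> i" using that by (auto simp: i_def)
    have "real i * cmod b = cmod (of_nat i * b)" by (simp add: norm_mult)
    also have "\<dots> = cmod ((\<beta> (J + i) - \<beta> J - of_nat i * b) + \<beta> J)"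
      using \<open>\<beta> k = 0\<close> k by (simp add: norm_minus_commute)
    also have "\<dots> \<le> real i * (cmod b / 2) + cmod (\<beta> J)"
      using norm_triangle_ineq dev[of i] by (meson add_mono order_refl order_trans)
    finally have "real i * (cmod b / 2) \<le> cmod (\<beta> J)" by simp
    moreover have "cmod (\<beta> J) < real i0 * (cmod b / 2)" using i0 b by (simp add: field_simps)
    moreover have "real i0 * (cmod b / 2) \<le> real i * (cmod b / 2)"
      using i b by (intro mult_right_mono) auto
    ultimately show False by linarith
  qed
  then show ?thesis by (intro that[of "J + i0 + 1"]) auto
qed

text \<open>If \<open>S(2N) > 2\<^sup>e\<^sup>+\<^sup>1 S(N)\<close> for all large \<open>N\<close>, iteration along \<open>2\<^sup>j M\<close> makes \<open>S\<close> grow faster than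
  \<open>N\<^sup>e\<close>. The factor depends on the exponent only, so it is 2 for every bounded \<open>S\<close>.\<close>

lemma polynomial_growth_doubling:
  fixes S :: "nat \<Rightarrow> real"
  assumes "mono S" and pos: "0 < S a" and growth: "\<And>N. S N \<le> C * real (N + 1) ^ e"
  obtains N where "N0 \<le> N" "S (2 * N) \<le> 2 ^ (e + 1) * S N"
proof (rule ccontr)
  assume "\<not> thesis"
  with that have *: "2 ^ (e + 1) * S N < S (2 * N)" if "N0 \<le> N" for N
    using \<open>N0 \<le> N\<close> not_le by blast
  define M where "M = max N0 a"
  have "S a \<le> S M" using assms(1) by (auto simp: mono_def M_def)
  with pos have SM: "0 < S M" by linarith
  have iter: "(2 ^ (e + 1)) ^ j * S M \<le> S (2 ^ j * M)" for j
  proof (induction j)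
    case (Suc j)
    have "1 * M \<le> 2 ^ j * M" by (intro mult_right_mono) auto
    then have "N0 \<le> 2 ^ j * M" by (simp add: M_def)
    from *[OF this] have "2 ^ (e + 1) * S (2 ^ j * M) \<le> S (2 ^ Suc j * M)" by (simp add: mult.assoc)
    moreover have "2 ^ (e + 1) * ((2 ^ (e + 1)) ^ j * S M) \<le> 2 ^ (e + 1) * S (2 ^ j * M)"
      by (intro mult_left_mono Suc) auto
    ultimately have "2 ^ (e + 1) * ((2 ^ (e + 1)) ^ j * S M) \<le> S (2 ^ Suc j * M)"
      by (rule order_trans[rotated])
    then show ?case by (simp add: mult.assoc)
  qed simp
  have C: "0 \<le> C"
  proof -
    have "0 < C * real (M + 1) ^ e" using SM growth[of M] by linarith
    then show ?thesis by (simp add: zero_less_mult_iff)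
  qed
  have "2 ^ j * S M \<le> C * real (M + 1) ^ e" for j
  proof -
    have "real (2 ^ j * M + 1) \<le> 2 ^ j * real (M + 1)" by (simp add: algebra_simps)
    then have "C * real (2 ^ j * M + 1) ^ e \<le> C * (2 ^ j * real (M + 1)) ^ e"
      by (intro mult_left_mono power_mono C) auto
    then have "(2 ^ (e + 1)) ^ j * S M \<le> (2 ^ j) ^ e * (C * real (M + 1) ^ e)"
      using iter[of j] growth[of "2 ^ j * M"] by (simp add: power_mult_distrib mult_ac)
    moreover have "(2 ^ (e + 1)) ^ j = (2 ^ j) ^ e * (2 ^ j :: real)"
      by (simp add: power_mult[symmetric] power_add[symmetric] algebra_simps)
    ultimately have "(2 ^ j) ^ e * (2 ^ j * S M) \<le> (2 ^ j) ^ e * (C * real (M + 1) ^ e)"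
      by (simp add: mult.assoc)
    then show ?thesis by (rule mult_left_le_imp_le) simp
  qed
  then have "2 ^ j \<le> C * real (M + 1) ^ e / S M" for j
    using SM by (simp add: pos_le_divide_eq)
  moreover obtain j where "C * real (M + 1) ^ e / S M < 2 ^ j"
    using real_arch_pow[of 2] by auto
  ultimately show False by (meson not_le)
qed

section \<open>Solutions of the homogeneous recurrences\<close>

text \<open>The solution of \<open>b(k) x(k+1) = a(k) x(k)\<close> for \<open>k \<ge> m\<close> with \<open>x(m) = 1\<close> when \<open>b\<close> has no zeros
  from \<open>m\<close> on, extended by zero below \<open>m\<close>.\<close>

definition recurrence_solution :: "(nat \<Rightarrow> complex) \<Rightarrow> (nat \<Rightarrow> complex) \<Rightarrow> nat \<Rightarrow> nat \<Rightarrow> complex" where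
  "recurrence_solution a b m k = (if k < m then 0 else \<Prod>j\<in>{m..<k}. a j / b j)"

lemma recurrence_solution_below: "k < m \<Longrightarrow> recurrence_solution a b m k = 0"
  by (simp add: recurrence_solution_def)

lemma recurrence_solution_start: "recurrence_solution a b m m = 1"
  by (simp add: recurrence_solution_def)

lemma recurrence_solution_step:
  "m \<le> k \<Longrightarrow> b k \<noteq> 0 \<Longrightarrow>
    b k * recurrence_solution a b m (Suc k) = a k * recurrence_solution a b m k"
  by (simp add: recurrence_solution_def)

text \<open>Up to a constant both sides are products of the same kind: raising \<open>N\<close> by one multiplies each by
  \<open>\<beta>(N+n+p) / \<beta>(N)\<close>, the values of \<open>\<alpha>\<close> having cancelled between the two solutions. The right-hand
  side has a number of factors that does not depend on \<open>N\<close>, and this is what makes the product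
  polynomially bounded.\<close>

lemma recurrence_solution_product:
  assumes n: "1 \<le> n" and \<beta>: "\<And>j. m \<le> j \<Longrightarrow> \<beta> j \<noteq> 0" and \<alpha>: "\<And>j. m + n - 1 \<le> j \<Longrightarrow> \<alpha> j \<noteq> 0"
    and N: "m \<le> N"
  shows "recurrence_solution (\<lambda>j. \<beta> (j + p)) \<alpha> (m + n - 1) (N + n)
      * (\<alpha> (N + n - 1) * recurrence_solution (\<lambda>j. \<alpha> (j + n - 1)) \<beta> m N) * (\<Prod>i<n + p. \<beta> (m + i))
    = \<beta> (m + n - 1 + p) * (\<Prod>i<n + p. \<beta> (N + i))"
  using N
proof (induction N rule: dec_induct)
  case base
  have "m + n = Suc (m + n - 1)" using n by simp
  then have "\<alpha> (m + n - 1) * recurrence_solution (\<lambda>j. \<beta> (j + p)) \<alpha> (m + n - 1) (m + n) = \<beta> (m + n - 1 + p)"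
    using recurrence_solution_step[of "m + n - 1" "m + n - 1" \<alpha> "\<lambda>j. \<beta> (j + p)"] \<alpha>[of "m + n - 1"]
    by (simp only: recurrence_solution_start) simp
  then show ?case by (simp add: recurrence_solution_start mult_ac)
next
  case (step N)
  let ?G = "recurrence_solution (\<lambda>j. \<beta> (j + p)) \<alpha> (m + n - 1)"
  let ?H = "recurrence_solution (\<lambda>j. \<alpha> (j + n - 1)) \<beta> m"
  let ?P = "\<lambda>N. \<Prod>i<n + p. \<beta> (N + i)"
  have G: "\<alpha> (N + n) * ?G (Suc (N + n)) = \<beta> (N + n + p) * ?G (N + n)"
    by (rule recurrence_solution_step) (use step \<alpha> in auto)
  have H: "\<beta> N * ?H (Suc N) = \<alpha> (N + n - 1) * ?H N"
    by (rule recurrence_solution_step) (use step \<beta> in auto)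
  have P: "\<beta> N * ?P (Suc N) = ?P N * \<beta> (N + n + p)"
    using prod.lessThan_Suc[of "\<lambda>i. \<beta> (N + i)" "n + p"]
      prod.lessThan_Suc_shift[of "\<lambda>i. \<beta> (N + i)" "n + p"] by (simp add: add.assoc)
  have "\<beta> N * (?G (Suc (N + n)) * (\<alpha> (N + n) * ?H (Suc N)) * ?P m)
      = (\<alpha> (N + n) * ?G (Suc (N + n))) * (\<beta> N * ?H (Suc N)) * ?P m"
    by (simp add: mult_ac)
  also have "\<dots> = \<beta> (N + n + p) * (?G (N + n) * (\<alpha> (N + n - 1) * ?H N) * ?P m)"
    unfolding G H by (simp add: mult_ac)
  also have "\<dots> = \<beta> (m + n - 1 + p) * (?P N * \<beta> (N + n + p))"
    unfolding step.IH by (simp add: mult_ac)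
  also have "\<dots> = \<beta> N * (\<beta> (m + n - 1 + p) * ?P (Suc N))"
    unfolding P[symmetric] by (simp add: mult_ac)
  finally have "?G (Suc (N + n)) * (\<alpha> (N + n) * ?H (Suc N)) * ?P m = \<beta> (m + n - 1 + p) * ?P (Suc N)"
    using \<beta>[OF step(1)] by simp
  then show ?case by simp
qed

section \<open>Homogeneous vectors\<close>

lemma positive_weight_gns: "(\<And>k. 0 < w k) \<Longrightarrow> positive_weight (gns_weight w)"
  by unfold_locales (auto simp: gns_weight_def split: prod.split)

definition in_degree :: "int \<Rightarrow> (nat \<Rightarrow> complex) \<Rightarrow> int \<times> nat \<Rightarrow> complex" where
  "in_degree d g = (\<lambda>(e, k). if e = d then g k else 0)"

lemma in_degree_apply: "in_degree d g (e, k) = (if e = d then g k else 0)"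
  by (simp add: in_degree_def)

lemma in_degree_zero:
  assumes "i \<notin> Pair d ` {..<M}" "\<And>k. M \<le> k \<Longrightarrow> g k = 0"
  shows "in_degree d g i = 0"
  using assms(1) assms(2)[of "snd i"] by (cases i) (force simp: in_degree_def)

lemma in_degree_norm:
  assumes "\<And>k. 0 < w k" "\<And>k. M \<le> k \<Longrightarrow> g k = 0"
  shows "in_degree d g \<in> wl2 (gns_weight w)"
    and "(wl2_norm (gns_weight w) (in_degree d g))\<^sup>2 = (\<Sum>k<M. gns_weight w (d, k) * (cmod (g k))\<^sup>2)"
proof -
  interpret positive_weight "gns_weight w" by (rule positive_weight_gns) (rule assms)
  note zero = in_degree_zero[where g = g, OF _ assms(2)]
  show "in_degree d g \<in> wl2 (gns_weight w)"
    by (rule wl2_finite_support(1)[OF _ zero]) auto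
  have "(wl2_norm (gns_weight w) (in_degree d g))\<^sup>2
      = (\<Sum>i\<in>Pair d ` {..<M}. gns_weight w i * (cmod (in_degree d g i))\<^sup>2)"
    by (rule wl2_finite_support(2)[OF _ zero]) auto
  also have "\<dots> = (\<Sum>k<M. gns_weight w (d, k) * (cmod (g k))\<^sup>2)"
    by (subst sum.reindex) (auto simp: inj_on_def in_degree_def)
  finally show "(wl2_norm (gns_weight w) (in_degree d g))\<^sup>2
      = (\<Sum>k<M. gns_weight w (d, k) * (cmod (g k))\<^sup>2)" .
qed

text \<open>Vectors whose degrees escape to infinity vanish eventually at each fixed coordinate.\<close>

lemma in_degree_null:
  assumes "filterlim d at_top sequentially \<or> filterlim d at_bot sequentially"
  shows "(\<lambda>i. in_degree (d i) (g i) x / c i) \<longlonglongrightarrow> 0"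
proof -
  obtain e k where x: "x = (e, k)" by (cases x)
  have "\<forall>\<^sub>F i in sequentially. d i \<noteq> e"
    using assms
  proof
    assume "filterlim d at_top sequentially"
    then have "\<forall>\<^sub>F i in sequentially. e + 1 \<le> d i" by (auto simp: filterlim_at_top)
    then show ?thesis by eventually_elim auto
  next
    assume "filterlim d at_bot sequentially"
    then have "\<forall>\<^sub>F i in sequentially. d i \<le> e - 1" unfolding filterlim_at_bot by blast
    then show ?thesis by eventually_elim auto
  qed
  then have "\<forall>\<^sub>F i in sequentially. in_degree (d i) (g i) x / c i = 0"
    by eventually_elim (auto simp: x in_degree_def)
  then show ?thesis by (rule tendsto_eventually)
qed

lemma D_expr_in_degree:
  "D_expr \<beta> \<alpha> (in_degree (int n) g) = in_degree (int n + 1) (D_plus \<beta> \<alpha> n g)"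
proof (rule ext, clarify)
  fix m :: int and k :: nat
  show "D_expr \<beta> \<alpha> (in_degree (int n) g) (m, k) = in_degree (int n + 1) (D_plus \<beta> \<alpha> n g) (m, k)"
    by (auto simp: D_expr_def in_degree_def D_plus_def D_minus_def prev_def split: nat.split)
qed

text \<open>Every coordinate of the expression involves finitely many coordinates of \<open>f\<close>, hence the closure
  is still given by it.\<close>

lemma D_max_graph:
  assumes w: "\<And>k. 0 < w k" and uv: "(u, v) \<in> D_max \<beta> \<alpha> w"
  shows "v = D_expr \<beta> \<alpha> u"
proof
  fix x :: "int \<times> nat"
  interpret positive_weight "gns_weight w" by (rule positive_weight_gns) (rule w)
  obtain s t where st: "\<And>n. t n = D_expr \<beta> \<alpha> (s n)"
    and s: "wl2_tendsto (gns_weight w) s u" and t: "wl2_tendsto (gns_weight w) t v"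
    using uv unfolding D_max_def op_closure_def by auto
  obtain m k where x: "x = (m, k)" by (cases x)
  have "(\<lambda>n. D_expr \<beta> \<alpha> (s n) x) \<longlonglongrightarrow> D_expr \<beta> \<alpha> u x"
    unfolding x D_expr_def D_plus_def D_minus_def prev_def
    by (auto intro!: tendsto_intros wl2_tendsto_coordinate[OF s] split: nat.split)
  then show "v x = D_expr \<beta> \<alpha> u x"
    using wl2_tendsto_coordinate[OF t, of x] LIMSEQ_unique unfolding st by blast
qed

section \<open>A derivation with compact parametrices\<close>

locale compact_parametrices =
  fixes w :: "nat \<Rightarrow> real" and \<beta> \<alpha> :: "nat \<Rightarrow> complex" and D :: "(int \<times> nat) graph"
  assumes w_pos: "\<And>k. 0 < w k"
    and closed: "closed_op (gns_weight w) D"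
    and extends_min: "D_min \<beta> \<alpha> w \<subseteq> D"
    and below_max: "D \<subseteq> D_max \<beta> \<alpha> w"
    and compact: "has_compact_parametrices (gns_weight w) D"
begin

sublocale positive_weight "gns_weight w" by (rule positive_weight_gns) (rule w_pos)

lemma w_sq_nonneg [simp]: "0 \<le> w k * x\<^sup>2"
  using w_pos[of k] by simp

lemma linear: "linear_op (gns_weight w) D"
  using closed by (simp add: closed_op_def)

lemma domain_in_degree:
  assumes g: "\<And>k. M \<le> k \<Longrightarrow> g k = 0"
  shows "(in_degree (int n) g, in_degree (int n + 1) (D_plus \<beta> \<alpha> n g)) \<in> D"
proof -
  have "in_degree (int n) g \<in> pol0"
    unfolding pol0_def mem_Collect_eq
  proof (intro conjI allI)
    show "finite {d. \<exists>k. in_degree (int n) g (d, k) \<noteq> 0}"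
      by (rule finite_subset[of _ "{int n}"]) (auto simp: in_degree_def split: if_splits)
    show "\<forall>\<^sub>F k in sequentially. in_degree (int n) g (d, k) = 0" for d
      using eventually_ge_at_top[of M] by eventually_elim (simp add: in_degree_def g)
  qed
  then have "(in_degree (int n) g, D_expr \<beta> \<alpha> (in_degree (int n) g)) \<in> {(f, D_expr \<beta> \<alpha> f) | f. f \<in> pol0}"
    by blast
  moreover have "wl2_tendsto (gns_weight w) (\<lambda>_. f) f" if "f \<in> wl2 (gns_weight w)" for f
    using that by (simp add: wl2_tendsto_def wl2_norm_def)
  moreover have "in_degree (int n) g \<in> wl2 (gns_weight w)"
    by (rule in_degree_norm(1)[where M = M]) (use w_pos g in auto)
  moreover have "in_degree (int n + 1) (D_plus \<beta> \<alpha> n g) \<in> wl2 (gns_weight w)"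
    by (rule in_degree_norm(1)[where M = M]) (use w_pos g in \<open>auto simp: D_plus_def\<close>)
  ultimately have "(in_degree (int n) g, D_expr \<beta> \<alpha> (in_degree (int n) g)) \<in> D_min \<beta> \<alpha> w"
    unfolding D_min_def op_closure_def mem_Collect_eq case_prod_conv
    by (intro exI[of _ "\<lambda>_. in_degree (int n) g"] exI[of _ "\<lambda>_. D_expr \<beta> \<alpha> (in_degree (int n) g)"])
      (simp add: D_expr_in_degree)
  then show ?thesis using extends_min by (auto simp: D_expr_in_degree)
qed

lemma gns_weight_negative:
  "gns_weight w (- int n, k) = w (k + n)"
  "1 \<le> n \<Longrightarrow> gns_weight w (1 - int n, k) = w (k + n - 1)"
proof -
  show "gns_weight w (- int n, k) = w (k + n)" by (simp add: gns_weight_def)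
  assume "1 \<le> n"
  then have "nat (int n - 1) = n - 1" by simp
  with \<open>1 \<le> n\<close> show "gns_weight w (1 - int n, k) = w (k + n - 1)"
    by (auto simp: gns_weight_def)
qed

text \<open>Summation by parts on a finite support. Dividing the coefficients by the weight turns the formal
  adjoint into a recurrence operator on \<open>H\<close> whose coefficients do not involve the weight.\<close>

lemma adjoint_in_degree:
  assumes n: "1 \<le> n" and H: "\<And>k. M \<le> k \<Longrightarrow> H k = 0"
  shows "(in_degree (1 - int n) (\<lambda>k. cnj (H k) / w (k + n - 1)),
      in_degree (- int n) (\<lambda>k. cnj (\<beta> k * H (k + 1) - \<alpha> (k + n - 1) * H k) / w (k + n)))
    \<in> adjoint_op (gns_weight w) D" (is "(?h, ?z) \<in> _")
  unfolding adjoint_op_def mem_Collect_eq case_prod_conv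
proof (intro conjI ballI)
  show "?h \<in> wl2 (gns_weight w)"
    by (rule in_degree_norm(1)[where M = M]) (use w_pos H in auto)
  show "?z \<in> wl2 (gns_weight w)"
    by (rule in_degree_norm(1)[where M = M]) (use w_pos H in auto)
  fix x assume xD: "x \<in> D"
  obtain u v where x: "x = (u, v)" by (cases x)
  define g where "g k = u (- int n, k)" for k
  have v: "v = D_expr \<beta> \<alpha> u"
    by (rule D_max_graph[of w]) (use w_pos below_max xD x in auto)
  have v_deg: "v (1 - int n, k) = prev \<beta> k * prev g k - \<alpha> (k + n - 1) * g k" for k
    using n by (simp add: v D_expr_def D_minus_def g_def[abs_def])
  have w0: "w k \<noteq> 0" for k using w_pos[of k] by simp
  have "wl2_inner (gns_weight w) v ?h
      = (\<Sum>i\<in>Pair (1 - int n) ` {..<M}. of_real (gns_weight w i) * v i * cnj (?h i))"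
    by (rule wl2_inner_finite_support) (use H in \<open>auto simp: in_degree_zero\<close>)
  also have "\<dots> = (\<Sum>k<M. v (1 - int n, k) * H k)"
    by (subst sum.reindex) (auto simp: inj_on_def in_degree_apply gns_weight_negative(2)[OF n] w0 simp del: One_nat_def)
  also have "\<dots> = (\<Sum>k<M. prev \<beta> k * prev g k * H k) - (\<Sum>k<M. \<alpha> (k + n - 1) * g k * H k)"
    by (simp add: v_deg sum_subtractf algebra_simps)
  also have "(\<Sum>k<M. prev \<beta> k * prev g k * H k) = (\<Sum>k<Suc M. prev \<beta> k * prev g k * H k)"
    by (simp add: H)
  also have "\<dots> = (\<Sum>k<M. \<beta> k * g k * H (k + 1))"
    by (subst sum.lessThan_Suc_shift) (simp add: prev_def)
  also have "\<dots> - (\<Sum>k<M. \<alpha> (k + n - 1) * g k * H k)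
      = (\<Sum>k<M. g k * (\<beta> k * H (k + 1) - \<alpha> (k + n - 1) * H k))"
    by (simp add: sum_subtractf[symmetric] algebra_simps)
  also have "\<dots> = (\<Sum>i\<in>Pair (- int n) ` {..<M}. of_real (gns_weight w i) * u i * cnj (?z i))"
    by (subst sum.reindex) (auto simp: inj_on_def in_degree_apply gns_weight_negative w0 g_def)
  also have "\<dots> = wl2_inner (gns_weight w) u ?z"
    by (rule wl2_inner_finite_support[symmetric]) (use H in \<open>auto simp: in_degree_zero\<close>)
  finally show "case x of (u, v) \<Rightarrow> wl2_inner (gns_weight w) v ?h = wl2_inner (gns_weight w) u ?z"
    by (simp add: x)
qed


section \<open>Cut-off solutions in the domain of the adjoint\<close>

text \<open>The image of a solution supported on \<open>[m, N]\<close> lives at the two ends. The lower end has squared norm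
  \<open>|\<beta>(m-1)|\<^sup>2 / w(m+n-1)\<close>, and the initial value of the solution alone contributes \<open>1 / w(m+n-1)\<close> to
  the squared norm of the vector: this is why the constant does not depend on \<open>n\<close>. By hypothesis
  the upper end has squared norm at most \<open>1 / w(m+n-1)\<close> as well.\<close>

lemma adjoint_truncated_solution:
  assumes n: "1 \<le> n" and m: "1 \<le> m" and \<beta>: "\<And>j. m \<le> j \<Longrightarrow> \<beta> j \<noteq> 0" and N: "m \<le> N"
    and small: "w (m + n - 1) *
      (cmod (\<alpha> (N + n - 1) * recurrence_solution (\<lambda>j. \<alpha> (j + n - 1)) \<beta> m N))\<^sup>2 \<le> w (N + n)"
  obtains g d where "(in_degree (1 - int n) g, d) \<in> adjoint_op (gns_weight w) D"
    "0 < wl2_norm (gns_weight w) (in_degree (1 - int n) g)"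
    "(wl2_norm (gns_weight w) d)\<^sup>2 \<le>
      ((cmod (\<beta> (m - 1)))\<^sup>2 + 1) * (wl2_norm (gns_weight w) (in_degree (1 - int n) g))\<^sup>2"
proof -
  let ?H = "recurrence_solution (\<lambda>j. \<alpha> (j + n - 1)) \<beta> m"
  define H where "H k = (if k \<le> N then ?H k else 0)" for k
  define g where "g k = cnj (H k) / w (k + n - 1)" for k
  define r where "r k = \<beta> k * H (k + 1) - \<alpha> (k + n - 1) * H k" for k
  define z where "z k = cnj (r k) / w (k + n)" for k
  have H0: "H k = 0" if "N + 1 \<le> k" for k using that by (simp add: H_def)
  have mem: "(in_degree (1 - int n) g, in_degree (- int n) z) \<in> adjoint_op (gns_weight w) D"
    using adjoint_in_degree[OF n, of "N + 1" H] H0 unfolding g_def[abs_def] z_def[abs_def] r_def by simp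
  have g_norm: "(wl2_norm (gns_weight w) (in_degree (1 - int n) g))\<^sup>2
      = (\<Sum>k<N + 1. w (k + n - 1) * (cmod (g k))\<^sup>2)"
    using in_degree_norm(2)[of w "N + 1" g "1 - int n"] w_pos H0
    by (simp only: gns_weight_negative(2)[OF n]) (simp add: g_def)
  have g_lower: "1 / w (m + n - 1) \<le> (wl2_norm (gns_weight w) (in_degree (1 - int n) g))\<^sup>2"
  proof -
    have "1 / w (m + n - 1) = w (m + n - 1) * (cmod (g m))\<^sup>2"
      using w_pos[of "m + n - 1"] N
      by (simp add: g_def H_def recurrence_solution_start norm_divide power2_eq_square)
    also have "\<dots> \<le> (\<Sum>k<N + 1. w (k + n - 1) * (cmod (g k))\<^sup>2)"
      by (rule member_le_sum[of m "{..<N + 1}" "\<lambda>k. w (k + n - 1) * (cmod (g k))\<^sup>2"])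
        (use N in auto)
    finally show ?thesis by (simp add: g_norm)
  qed
  \<comment> \<open>Only the two ends of the truncated solution contribute to its image.\<close>
  have r: "r k = (if k = m - 1 then \<beta> (m - 1) else 0)
      + (if k = N then - (\<alpha> (N + n - 1) * ?H N) else 0)" if "k < N + 1" for k
  proof -
    have "k < m - 1 \<or> k = m - 1 \<or> m \<le> k \<and> k < N \<or> k = N" using that by linarith
    then consider "k < m - 1" | "k = m - 1" | "m \<le> k" "k < N" | "k = N" by blast
    then show ?thesis
    proof cases
      case 3
      then show ?thesis using recurrence_solution_step[of m k \<beta> "\<lambda>j. \<alpha> (j + n - 1)"] \<beta> m
        by (simp add: r_def H_def)
    next
      case 2
      then show ?thesis using m N
        by (simp add: r_def H_def recurrence_solution_below recurrence_solution_start)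
    qed (use m N in \<open>auto simp: r_def H_def recurrence_solution_below\<close>)
  qed
  have "(wl2_norm (gns_weight w) (in_degree (- int n) z))\<^sup>2
      = (\<Sum>k<N + 1. w (k + n) * (cmod (z k))\<^sup>2)"
    using in_degree_norm(2)[of w "N + 1" z "- int n"] w_pos H0
    by (simp add: gns_weight_negative z_def r_def)
  also have "\<dots> = (\<Sum>k<N + 1. (if k = m - 1 then (cmod (\<beta> (m - 1)))\<^sup>2 / w (m + n - 1) else 0)
      + (if k = N then (cmod (\<alpha> (N + n - 1) * ?H N))\<^sup>2 / w (N + n) else 0))"
  proof (rule sum.cong[OF refl])
    fix k assume "k \<in> {..<N + 1}"
    then have k: "k < N + 1" by simp
    have w: "w (k + n) * (cmod (z k))\<^sup>2 = (cmod (r k))\<^sup>2 / w (k + n)"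
      using w_pos[of "k + n"] by (simp add: z_def norm_divide power2_eq_square)
    show "w (k + n) * (cmod (z k))\<^sup>2 = (if k = m - 1 then (cmod (\<beta> (m - 1)))\<^sup>2 / w (m + n - 1) else 0)
      + (if k = N then (cmod (\<alpha> (N + n - 1) * ?H N))\<^sup>2 / w (N + n) else 0)"
      unfolding w r[OF k] using m N by auto
  qed
  also have "\<dots> = (cmod (\<beta> (m - 1)))\<^sup>2 / w (m + n - 1) + (cmod (\<alpha> (N + n - 1) * ?H N))\<^sup>2 / w (N + n)"
    using m N by (simp add: sum.distrib)
  also have "\<dots> \<le> ((cmod (\<beta> (m - 1)))\<^sup>2 + 1) * (1 / w (m + n - 1))"
    using small w_pos[of "N + n"] w_pos[of "m + n - 1"] by (simp add: field_simps)
  also have "\<dots> \<le> ((cmod (\<beta> (m - 1)))\<^sup>2 + 1)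
      * (wl2_norm (gns_weight w) (in_degree (1 - int n) g))\<^sup>2"
    by (rule mult_left_mono[OF g_lower]) simp
  finally have d: "(wl2_norm (gns_weight w) (in_degree (- int n) z))\<^sup>2 \<le>
      ((cmod (\<beta> (m - 1)))\<^sup>2 + 1) * (wl2_norm (gns_weight w) (in_degree (1 - int n) g))\<^sup>2" .
  have "0 < 1 / w (m + n - 1)" using w_pos by simp
  with g_lower have "0 < wl2_norm (gns_weight w) (in_degree (1 - int n) g)"
    by (metis less_le_not_le order_less_le_trans wl2_norm_nonneg zero_less_power2 zero_power2 order_le_less)
  with mem d show ?thesis using that by blast
qed

text \<open>If no \<open>n\<close> works, \<open>adjoint_truncated_solution\<close> applies in every degree \<open>1 - n\<close> and yields vectors in
  the domain of \<open>D\<^sup>*\<close> whose degrees tend to \<open>-\<infinity>\<close>. The conclusion also forces \<open>\<alpha>\<close> to be nonzero from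
  \<open>m + n - 1\<close> on.\<close>

lemma adjoint_solution_lower_bound:
  assumes m: "1 \<le> m" and \<beta>: "\<And>j. m \<le> j \<Longrightarrow> \<beta> j \<noteq> 0"
  obtains n where "1 \<le> n" "\<And>N. m \<le> N \<Longrightarrow> w (N + n) < w (m + n - 1) *
    (cmod (\<alpha> (N + n - 1) * recurrence_solution (\<lambda>j. \<alpha> (j + n - 1)) \<beta> m N))\<^sup>2"
proof (rule ccontr)
  assume no: "\<not> thesis"
  let ?C = "(cmod (\<beta> (m - 1)))\<^sup>2 + 1"
  \<comment> \<open>The degree \<open>- i\<close> corresponds to \<open>n = i + 1\<close>.\<close>
  have "\<exists>g d. (in_degree (- int i) g, d) \<in> adjoint_op (gns_weight w) D \<and>
      0 < wl2_norm (gns_weight w) (in_degree (- int i) g) \<and>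
      (wl2_norm (gns_weight w) d)\<^sup>2 \<le> ?C * (wl2_norm (gns_weight w) (in_degree (- int i) g))\<^sup>2" for i
  proof -
    have "1 \<le> Suc i" by simp
    from that[OF this] no obtain N where N: "m \<le> N"
      and small: "\<not> w (N + Suc i) < w (m + Suc i - 1) *
        (cmod (\<alpha> (N + Suc i - 1) * recurrence_solution (\<lambda>j. \<alpha> (j + Suc i - 1)) \<beta> m N))\<^sup>2"
      by blast
    obtain g d where "(in_degree (1 - int (Suc i)) g, d) \<in> adjoint_op (gns_weight w) D"
      "0 < wl2_norm (gns_weight w) (in_degree (1 - int (Suc i)) g)"
      "(wl2_norm (gns_weight w) d)\<^sup>2 \<le>
        ?C * (wl2_norm (gns_weight w) (in_degree (1 - int (Suc i)) g))\<^sup>2"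
      by (rule adjoint_truncated_solution[where n = "Suc i", OF _ m \<beta> N]) (use small in \<open>auto simp: not_less\<close>)
    then show ?thesis by auto
  qed
  then obtain g d where gd: "\<And>i. (in_degree (- int i) (g i), d i) \<in> adjoint_op (gns_weight w) D"
      "\<And>i. 0 < wl2_norm (gns_weight w) (in_degree (- int i) (g i))"
      "\<And>i. (wl2_norm (gns_weight w) (d i))\<^sup>2 \<le>
        ?C * (wl2_norm (gns_weight w) (in_degree (- int i) (g i)))\<^sup>2"
    by metis
  have "filterlim (\<lambda>i. - int i) at_bot sequentially"
    unfolding filterlim_at_bot
  proof
    show "\<forall>\<^sub>F i in sequentially. - int i \<le> Z" for Z
      using eventually_ge_at_top[of "nat (- Z)"] by eventually_elim linarith
  qed
  then have "\<forall>x. (\<lambda>i. in_degree (- int i) (g i) x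
      / of_real (wl2_norm (gns_weight w) (in_degree (- int i) (g i)))) \<longlonglongrightarrow> 0"
    by (intro allI in_degree_null disjI2)
  with compact_parametrices_adjoint[where f = "\<lambda>i. in_degree (- int i) (g i)", OF linear compact gd]
  show False by blast
qed

section \<open>Cut-off solutions in the domain of the derivation\<close>

definition solution_mass :: "nat \<Rightarrow> nat \<Rightarrow> nat \<Rightarrow> real" where
  "solution_mass m p N = (\<Sum>k\<le>N. w k * (cmod (recurrence_solution (\<lambda>j. \<beta> (j + p)) \<alpha> m k))\<^sup>2)"

lemma mono_solution_mass: "mono (solution_mass m p)"
  unfolding solution_mass_def
  by (intro monoI sum_mono2) auto

lemma solution_mass_lower: "m \<le> N \<Longrightarrow> w m \<le> solution_mass m p N"
  using member_le_sum[of m "{..N}" "\<lambda>k. w k * (cmod (recurrence_solution (\<lambda>j. \<beta> (j + p)) \<alpha> m k))\<^sup>2"]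
    less_imp_le[OF w_pos]
  by (simp add: solution_mass_def recurrence_solution_start)

text \<open>Cutting the solution off by a tent costs the value of \<open>\<beta>(k+p)\<close> times the slope \<open>1/2N\<close>. On the support
  \<open>k < 2N\<close>, and with \<open>p \<le> N\<close>, the former is at most \<open>3LN\<close>; this yields the constant \<open>3L/2\<close>, the same for
  all \<open>p\<close>. The term with \<open>\<alpha>(m-1)\<close> comes from the start of the solution at \<open>m\<close>, and division by \<open>w(m)\<close>
  makes it relative to the mass, which is at least \<open>w(m)\<close>. The tent is at least one half on \<open>k \<le> N\<close>, whence the lower bound for the norm.\<close>

lemma tent_vector:
  assumes L: "0 \<le> L" "\<And>k. cmod (\<beta> k) \<le> L * real (k + 1)"
    and m: "1 \<le> m" and \<alpha>: "\<And>j. m \<le> j \<Longrightarrow> \<alpha> j \<noteq> 0" and N: "m \<le> N" "p \<le> N"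
  obtains f d where "(in_degree (int p) f, d) \<in> D"
    "\<And>k. cmod (f k) \<le> cmod (recurrence_solution (\<lambda>j. \<beta> (j + p)) \<alpha> m k)"
    "solution_mass m p N / 4 \<le> (wl2_norm (gns_weight w) (in_degree (int p) f))\<^sup>2"
    "(wl2_norm (gns_weight w) d)\<^sup>2 \<le>
      (w (m - 1) * (cmod (\<alpha> (m - 1)))\<^sup>2 / w m + (3 * L / 2)\<^sup>2) * solution_mass m p (2 * N)"
proof -
  let ?G = "recurrence_solution (\<lambda>j. \<beta> (j + p)) \<alpha> m"
  define t where "t k = max 0 (1 - real k / real (2 * N))" for k
  define f where "f k = of_real (t k) * ?G k" for k
  have N0: "0 < N" using m N by simp
  have t01: "0 \<le> t k" "t k \<le> 1" for k by (auto simp: t_def)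
  have t_end: "t k = 0" if "2 * N \<le> k" for k
  proof -
    have "1 \<le> real k / real (2 * N)"
      using that N0 by (subst pos_le_divide_eq) (simp_all flip: of_nat_mult)
    then show ?thesis by (simp add: t_def)
  qed
  have t_half: "1 / 2 \<le> t k" if "k \<le> N" for k
  proof -
    have "real k / real (2 * N) \<le> 1 / 2" using that N0 by (simp add: field_simps)
    then show ?thesis by (simp add: t_def)
  qed
  have t_step: "\<bar>t k - t (k + 1)\<bar> \<le> 1 / real (2 * N)" for k
  proof -
    have "real (k + 1) / real (2 * N) = real k / real (2 * N) + 1 / real (2 * N)"
      by (simp add: add_divide_distrib)
    moreover have "0 \<le> 1 / real (2 * N)" by simp
    ultimately show ?thesis unfolding t_def by linarith
  qed
  have f0: "f k = 0" if "2 * N \<le> k" for k using t_end[OF that] by (simp add: f_def)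
  have f_le: "cmod (f k) \<le> cmod (?G k)" for k
    using mult_right_mono[OF t01(2)[of k], of "cmod (?G k)"] t01(1)[of k] by (simp add: f_def norm_mult)
  have lower: "solution_mass m p N / 4 \<le> (wl2_norm (gns_weight w) (in_degree (int p) f))\<^sup>2"
  proof -
    have "solution_mass m p N / 4 = (\<Sum>k\<le>N. w k * ((cmod (?G k))\<^sup>2 / 4))"
      by (simp add: solution_mass_def sum_divide_distrib)
    also have "\<dots> \<le> (\<Sum>k\<le>N. w k * (cmod (f k))\<^sup>2)"
    proof (intro sum_mono mult_left_mono)
      fix k assume "k \<in> {..N}"
      then have "(1 / 2)\<^sup>2 \<le> (t k)\<^sup>2" by (intro power_mono t_half) auto
      then have "(1 / 2)\<^sup>2 * (cmod (?G k))\<^sup>2 \<le> (t k)\<^sup>2 * (cmod (?G k))\<^sup>2"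
        by (rule mult_right_mono) simp
      then show "(cmod (?G k))\<^sup>2 / 4 \<le> (cmod (f k))\<^sup>2"
        by (simp add: f_def norm_mult power_mult_distrib power_divide)
    qed (use w_pos in \<open>auto intro: less_imp_le\<close>)
    also have "\<dots> \<le> (\<Sum>k<2 * N. w k * (cmod (f k))\<^sup>2)"
      by (rule sum_mono2) (use N0 in auto)
    also have "\<dots> = (wl2_norm (gns_weight w) (in_degree (int p) f))\<^sup>2"
      using in_degree_norm(2)[of w "2 * N" f "int p"] w_pos f0 by (simp add: gns_weight_def)
    finally show ?thesis .
  qed
  let ?B = "w (m - 1) * (cmod (\<alpha> (m - 1)))\<^sup>2"
  \<comment> \<open>Inside the support the recurrence leaves only the slope of the tent, which compensates
    the linear growth of the coefficient.\<close>
  have pointwise: "w k * (cmod (D_plus \<beta> \<alpha> p f k))\<^sup>2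
      \<le> (if k = m - 1 then ?B else 0) + (3 * L / 2)\<^sup>2 * (w k * (cmod (?G k))\<^sup>2)"
    if k: "k < 2 * N" for k
  proof -
    consider "k < m - 1" | "k = m - 1" | "m \<le> k" by linarith
    then show ?thesis
    proof cases
      case 1
      then have "D_plus \<beta> \<alpha> p f k = 0" by (simp add: D_plus_def f_def recurrence_solution_below)
      then show ?thesis using 1 w_pos[of k] by simp
    next
      case 2
      then have "D_plus \<beta> \<alpha> p f k = - (\<alpha> (m - 1) * of_real (t m))"
        using m by (simp add: D_plus_def f_def recurrence_solution_below recurrence_solution_start)
      then have "cmod (D_plus \<beta> \<alpha> p f k) \<le> cmod (\<alpha> (m - 1))"
        using mult_left_mono[OF t01(2)[of m], of "cmod (\<alpha> (m - 1))"] t01(1)[of m] by (simp add: norm_mult)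
      then have "w k * (cmod (D_plus \<beta> \<alpha> p f k))\<^sup>2 \<le> w k * (cmod (\<alpha> (m - 1)))\<^sup>2"
        using w_pos[of k] by (intro mult_left_mono power_mono) auto
      then show ?thesis using 2 m by (simp add: recurrence_solution_below)
    next
      case 3
      have "\<alpha> k * ?G (Suc k) = \<beta> (k + p) * ?G k"
        using recurrence_solution_step[of m k \<alpha> "\<lambda>j. \<beta> (j + p)"] 3 \<alpha> by simp
      then have "D_plus \<beta> \<alpha> p f k = \<beta> (k + p) * ?G k * of_real (t k - t (k + 1))"
        by (simp add: D_plus_def f_def algebra_simps)
      then have "cmod (D_plus \<beta> \<alpha> p f k) = (cmod (\<beta> (k + p)) * \<bar>t k - t (k + 1)\<bar>) * cmod (?G k)"
        by (simp add: norm_mult flip: of_real_diff)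
      also have "\<dots> \<le> (3 * L / 2) * cmod (?G k)"
      proof (rule mult_right_mono)
        have "cmod (\<beta> (k + p)) \<le> L * real (k + p + 1)" by (rule L)
        also have "\<dots> \<le> L * real (3 * N)" using k N L(1) by (intro mult_left_mono) auto
        finally have "cmod (\<beta> (k + p)) * \<bar>t k - t (k + 1)\<bar> \<le> (L * real (3 * N)) * (1 / real (2 * N))"
          by (intro mult_mono t_step) (use L(1) in auto)
        then show "cmod (\<beta> (k + p)) * \<bar>t k - t (k + 1)\<bar> \<le> 3 * L / 2"
          using N0 by (simp add: field_simps)
      qed simp
      finally have "(cmod (D_plus \<beta> \<alpha> p f k))\<^sup>2 \<le> ((3 * L / 2) * cmod (?G k))\<^sup>2"
        by (rule power_mono) simp
      also have "\<dots> = (3 * L / 2)\<^sup>2 * (cmod (?G k))\<^sup>2" by (rule power_mult_distrib)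
      finally have "w k * (cmod (D_plus \<beta> \<alpha> p f k))\<^sup>2 \<le> w k * ((3 * L / 2)\<^sup>2 * (cmod (?G k))\<^sup>2)"
        by (rule mult_left_mono) (use w_pos[of k] in simp)
      then have "w k * (cmod (D_plus \<beta> \<alpha> p f k))\<^sup>2 \<le> (3 * L / 2)\<^sup>2 * (w k * (cmod (?G k))\<^sup>2)"
        by (simp only: mult.left_commute)
      moreover have "k \<noteq> m - 1" using 3 m by simp
      ultimately show ?thesis by simp
    qed
  qed
  have upper: "(wl2_norm (gns_weight w) (in_degree (int p + 1) (D_plus \<beta> \<alpha> p f)))\<^sup>2
      \<le> (?B / w m + (3 * L / 2)\<^sup>2) * solution_mass m p (2 * N)"
  proof -
    have "(wl2_norm (gns_weight w) (in_degree (int p + 1) (D_plus \<beta> \<alpha> p f)))\<^sup>2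
        = (\<Sum>k<2 * N. w k * (cmod (D_plus \<beta> \<alpha> p f k))\<^sup>2)"
      using in_degree_norm(2)[of w "2 * N" "D_plus \<beta> \<alpha> p f" "int p + 1"] w_pos f0
      by (simp add: gns_weight_def D_plus_def)
    also have "\<dots> \<le> (\<Sum>k<2 * N. (if k = m - 1 then ?B else 0) + (3 * L / 2)\<^sup>2 * (w k * (cmod (?G k))\<^sup>2))"
      by (intro sum_mono pointwise) simp
    also have "\<dots> = ?B + (3 * L / 2)\<^sup>2 * (\<Sum>k<2 * N. w k * (cmod (?G k))\<^sup>2)"
      using m N by (simp add: sum.distrib sum_distrib_left)
    also have "\<dots> \<le> ?B / w m * solution_mass m p (2 * N) + (3 * L / 2)\<^sup>2 * solution_mass m p (2 * N)"
    proof (intro add_mono mult_left_mono)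
      have "?B / w m * w m \<le> ?B / w m * solution_mass m p (2 * N)"
        using N less_imp_le[OF w_pos]
        by (intro mult_left_mono solution_mass_lower divide_nonneg_nonneg) auto
      then show "?B \<le> ?B / w m * solution_mass m p (2 * N)" using w_pos[of m] by simp
      show "(\<Sum>k<2 * N. w k * (cmod (?G k))\<^sup>2) \<le> solution_mass m p (2 * N)"
        unfolding solution_mass_def
        by (rule sum_mono2) auto
    qed simp
    finally show ?thesis by (simp add: algebra_simps)
  qed
  show ?thesis
    using domain_in_degree[of "2 * N" f p] f0 f_le lower upper by (intro that) auto
qed


text \<open>The lower bound for \<open>|\<alpha>(N+n-1) H(N)|\<^sup>2\<close> bounds \<open>w(k) |G(k)|\<^sup>2\<close>, for \<open>k = N + n\<close>, by the square of the
  product in \<open>recurrence_solution_product\<close>, which is a constant times \<open>n + p\<close> factors of at most linear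
  growth.\<close>

lemma solution_mass_polynomial_growth:
  assumes L: "0 \<le> L" "\<And>k. cmod (\<beta> k) \<le> L * real (k + 1)"
    and n: "1 \<le> n" and \<beta>: "\<And>j. m \<le> j \<Longrightarrow> \<beta> j \<noteq> 0" and \<alpha>: "\<And>j. m + n - 1 \<le> j \<Longrightarrow> \<alpha> j \<noteq> 0"
    and lower: "\<And>N. m \<le> N \<Longrightarrow> w (N + n) < w (m + n - 1) *
      (cmod (\<alpha> (N + n - 1) * recurrence_solution (\<lambda>j. \<alpha> (j + n - 1)) \<beta> m N))\<^sup>2"
  obtains C e where "\<And>N. solution_mass (m + n - 1) p N \<le> C * real (N + 1) ^ e"
proof -
  let ?G = "recurrence_solution (\<lambda>j. \<beta> (j + p)) \<alpha> (m + n - 1)"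
  let ?H = "recurrence_solution (\<lambda>j. \<alpha> (j + n - 1)) \<beta> m"
  let ?P = "\<lambda>N. \<Prod>i<n + p. \<beta> (N + i)"
  let ?S = "solution_mass (m + n - 1) p"
  define c where "c = cmod (\<beta> (m + n - 1 + p) / ?P m)"
  define C where "C = w (m + n - 1) * (c * (L * real (p + 1)) ^ (n + p))\<^sup>2"
  have Pm: "?P m \<noteq> 0" using \<beta> by simp
  have C: "0 \<le> C" by (simp add: C_def)
  have S: "0 \<le> ?S N" for N by (simp add: solution_mass_def sum_nonneg)
  have far: "w k * (cmod (?G k))\<^sup>2 \<le> C * (real (k + 1) ^ (n + p))\<^sup>2" if k: "m + n \<le> k" for k
  proof -
    define N where "N = k - n"
    have N: "m \<le> N" "k = N + n" using k by (auto simp: N_def)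
    have eq: "?G k * (\<alpha> (N + n - 1) * ?H N) = \<beta> (m + n - 1 + p) / ?P m * ?P N"
      using recurrence_solution_product[where p = p, OF n \<beta> \<alpha> N(1)] Pm
      by (simp add: N(2) field_simps)
    have "cmod (?P N) = (\<Prod>i<n + p. cmod (\<beta> (N + i)))" by (simp add: prod_norm)
    also have "\<dots> \<le> (\<Prod>i<n + p. L * real (p + 1) * real (k + 1))"
    proof (rule prod_mono, intro conjI)
      fix i assume "i \<in> {..<n + p}"
      then have "N + i + 1 \<le> (p + 1) * (k + 1)" by (simp add: N(2) algebra_simps)
      then have "real (N + i + 1) \<le> real (p + 1) * real (k + 1)" by (metis of_nat_le_iff of_nat_mult)
      then have "L * real (N + i + 1) \<le> L * (real (p + 1) * real (k + 1))"
        using L(1) by (rule mult_left_mono)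
      then show "cmod (\<beta> (N + i)) \<le> L * real (p + 1) * real (k + 1)"
        using L(2)[of "N + i"] by (simp add: mult.assoc)
    qed simp
    also have "\<dots> = (L * real (p + 1)) ^ (n + p) * real (k + 1) ^ (n + p)"
      by (simp add: power_mult_distrib)
    finally have P: "cmod (?P N) \<le> (L * real (p + 1)) ^ (n + p) * real (k + 1) ^ (n + p)" .
    have "w k * (cmod (?G k))\<^sup>2 \<le> (w (m + n - 1) * (cmod (\<alpha> (N + n - 1) * ?H N))\<^sup>2) * (cmod (?G k))\<^sup>2"
      using lower[OF N(1)] by (intro mult_right_mono) (auto simp: N(2))
    also have "\<dots> = w (m + n - 1) * (cmod (?G k * (\<alpha> (N + n - 1) * ?H N)))\<^sup>2"
      by (simp add: norm_mult power_mult_distrib mult_ac)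
    also have "\<dots> = w (m + n - 1) * (c * cmod (?P N))\<^sup>2"
      unfolding eq norm_mult c_def ..
    also have "\<dots> \<le> w (m + n - 1) * (c * ((L * real (p + 1)) ^ (n + p) * real (k + 1) ^ (n + p)))\<^sup>2"
      by (intro mult_left_mono power_mono P) (auto simp: c_def less_imp_le[OF w_pos])
    also have "\<dots> = C * (real (k + 1) ^ (n + p))\<^sup>2"
      by (simp add: C_def power_mult_distrib mult_ac)
    finally show ?thesis .
  qed
  \<comment> \<open>The finitely many indices below \<open>m + n\<close> are absorbed into the constant.\<close>
  have all: "w k * (cmod (?G k))\<^sup>2 \<le> (C + ?S (m + n)) * (real (k + 1) ^ (n + p))\<^sup>2" for k
  proof (cases "m + n \<le> k")
    case True
    have "C * (real (k + 1) ^ (n + p))\<^sup>2 \<le> (C + ?S (m + n)) * (real (k + 1) ^ (n + p))\<^sup>2"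
      by (rule mult_right_mono) (use S in auto)
    with far[OF True] show ?thesis by linarith
  next
    case False
    have "w k * (cmod (?G k))\<^sup>2 \<le> ?S (m + n)"
      unfolding solution_mass_def
      by (rule member_le_sum[of k "{..m + n}" "\<lambda>k. w k * (cmod (?G k))\<^sup>2"]) (use False in auto)
    also have "\<dots> \<le> (C + ?S (m + n)) * 1" using C by simp
    also have "\<dots> \<le> (C + ?S (m + n)) * (real (k + 1) ^ (n + p))\<^sup>2"
      by (intro mult_left_mono one_le_power) (use C S in auto)
    finally show ?thesis .
  qed
  have "?S N \<le> (C + ?S (m + n)) * real (N + 1) ^ Suc (2 * (n + p))" for N
  proof -
    have "?S N \<le> (\<Sum>k\<le>N. (C + ?S (m + n)) * (real (N + 1) ^ (n + p))\<^sup>2)"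
      unfolding solution_mass_def[of _ _ N]
    proof (rule sum_mono)
      fix k assume "k \<in> {..N}"
      then have "(C + ?S (m + n)) * (real (k + 1) ^ (n + p))\<^sup>2
          \<le> (C + ?S (m + n)) * (real (N + 1) ^ (n + p))\<^sup>2"
        by (intro mult_left_mono power_mono) (use C S in auto)
      with all[of k] show "w k * (cmod (?G k))\<^sup>2 \<le> (C + ?S (m + n)) * (real (N + 1) ^ (n + p))\<^sup>2"
        by linarith
    qed
    also have "\<dots> = (C + ?S (m + n)) * real (N + 1) ^ Suc (2 * (n + p))"
      by (simp add: power_mult[symmetric] mult_ac)
    finally show ?thesis .
  qed
  then show ?thesis by (rule that)
qed

text \<open>Normalised tents at places where doubling \<open>N\<close> multiplies the mass of the solution by a bounded
  factor are bounded in the graph norm of \<open>D\<close>. They tend to zero in each coordinate in one of two ways: their degrees tend to infinity,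
  or the degree is fixed and their norms before normalisation tend to infinity while each coordinate
  stays bounded by that of the solution.\<close>

lemma no_doubling_sequence:
  assumes L: "0 \<le> L" "\<And>k. cmod (\<beta> k) \<le> L * real (k + 1)"
    and m: "1 \<le> m" and \<alpha>: "\<And>j. m \<le> j \<Longrightarrow> \<alpha> j \<noteq> 0"
    and N: "\<And>i. m \<le> N i" "\<And>i. p i \<le> N i"
    and doubling: "\<And>i. solution_mass m (p i) (2 * N i) \<le> K * solution_mass m (p i) (N i)"
    and escape: "filterlim p at_top sequentially \<or>
      (\<exists>q. p = (\<lambda>_. q) \<and> filterlim (\<lambda>i. solution_mass m q (N i)) at_top sequentially)"
  shows False
proof -
  let ?S = "solution_mass m"
  let ?n = "wl2_norm (gns_weight w)"
  let ?C = "w (m - 1) * (cmod (\<alpha> (m - 1)))\<^sup>2 / w m + (3 * L / 2)\<^sup>2"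
  have C: "0 \<le> ?C" using w_pos[of m] by (intro add_nonneg_nonneg divide_nonneg_pos) auto
  have "\<exists>f d. (in_degree (int (p i)) f, d) \<in> D \<and>
      (\<forall>k. cmod (f k) \<le> cmod (recurrence_solution (\<lambda>j. \<beta> (j + p i)) \<alpha> m k)) \<and>
      ?S (p i) (N i) / 4 \<le> (?n (in_degree (int (p i)) f))\<^sup>2 \<and> (?n d)\<^sup>2 \<le> ?C * ?S (p i) (2 * N i)" for i
    using tent_vector[OF L m \<alpha> N(1)[of i] N(2)[of i]] by metis
  then obtain f d where fD: "\<And>i. (in_degree (int (p i)) (f i), d i) \<in> D"
    and f_le: "\<And>i k. cmod (f i k) \<le> cmod (recurrence_solution (\<lambda>j. \<beta> (j + p i)) \<alpha> m k)"
    and f_norm: "\<And>i. ?S (p i) (N i) / 4 \<le> (?n (in_degree (int (p i)) (f i)))\<^sup>2"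
    and d: "\<And>i. (?n (d i))\<^sup>2 \<le> ?C * ?S (p i) (2 * N i)"
    by metis
  have f_pos: "0 < ?n (in_degree (int (p i)) (f i))" for i
  proof -
    have "0 < ?S (p i) (N i) / 4" using solution_mass_lower[OF N(1)] w_pos[of m] by (smt (verit) divide_pos_pos)
    with f_norm[of i] have "0 < (?n (in_degree (int (p i)) (f i)))\<^sup>2" by linarith
    then show ?thesis using wl2_norm_nonneg by (metis zero_less_power2 order_le_less)
  qed
  have d_le: "(?n (d i))\<^sup>2 \<le> (?C * \<bar>K\<bar> * 4) * (?n (in_degree (int (p i)) (f i)))\<^sup>2" for i
  proof -
    have S0: "0 \<le> ?S (p i) (N i)" by (simp add: solution_mass_def sum_nonneg)
    have "K * ?S (p i) (N i) \<le> \<bar>K\<bar> * ?S (p i) (N i)" by (rule mult_right_mono[OF abs_ge_self S0])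
    also have "\<dots> \<le> \<bar>K\<bar> * (4 * (?n (in_degree (int (p i)) (f i)))\<^sup>2)"
      using f_norm[of i] by (intro mult_left_mono) auto
    finally have "?S (p i) (2 * N i) \<le> \<bar>K\<bar> * (4 * (?n (in_degree (int (p i)) (f i)))\<^sup>2)"
      using doubling[of i] by linarith
    then have "?C * ?S (p i) (2 * N i) \<le> ?C * (\<bar>K\<bar> * (4 * (?n (in_degree (int (p i)) (f i)))\<^sup>2))"
      using C by (rule mult_left_mono)
    with d[of i] show ?thesis by (simp add: mult.assoc)
  qed
  have "(\<lambda>i. in_degree (int (p i)) (f i) x / of_real (?n (in_degree (int (p i)) (f i)))) \<longlonglongrightarrow> 0" for x
    using escape
  proof
    assume "filterlim p at_top sequentially"
    then have "filterlim (\<lambda>i. int (p i)) at_top sequentially"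
      by (rule filterlim_compose[OF filterlim_int_sequentially])
    then show ?thesis by (intro in_degree_null disjI1)
  next
    assume "\<exists>q. p = (\<lambda>_. q) \<and> filterlim (\<lambda>i. ?S q (N i)) at_top sequentially"
    then obtain q where q: "p = (\<lambda>_. q)" and S: "filterlim (\<lambda>i. ?S q (N i)) at_top sequentially" by blast
    obtain e k where x: "x = (e, k)" by (cases x)
    let ?g = "cmod (recurrence_solution (\<lambda>j. \<beta> (j + q)) \<alpha> m k)"
    show ?thesis
    proof (rule Lim_null_comparison)
      show "\<forall>\<^sub>F i in sequentially. norm (in_degree (int (p i)) (f i) x
          / of_real (?n (in_degree (int (p i)) (f i)))) \<le> ?g / sqrt (?S q (N i) / 4)"
      proof (rule always_eventually, rule allI)
        fix i
        have pos: "0 < ?S q (N i) / 4" using solution_mass_lower[OF N(1)] w_pos[of m] by (smt (verit) divide_pos_pos)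
        have "sqrt (?S q (N i) / 4) \<le> ?n (in_degree (int (p i)) (f i))"
          using f_norm[of i] wl2_norm_nonneg by (intro real_le_lsqrt) (auto simp: q)
        moreover have "cmod (in_degree (int (p i)) (f i) x) \<le> ?g"
          using f_le[of i k] by (simp add: x in_degree_def q)
        ultimately show "norm (in_degree (int (p i)) (f i) x
            / of_real (?n (in_degree (int (p i)) (f i)))) \<le> ?g / sqrt (?S q (N i) / 4)"
          using f_pos[of i] pos by (simp add: norm_divide frac_le)
      qed
      have "filterlim (\<lambda>i. sqrt ((1 / 4) * ?S q (N i))) at_top sequentially"
        by (intro filterlim_compose[OF sqrt_at_top] filterlim_tendsto_pos_mult_at_top[OF tendsto_const _ S]) simp
      then show "(\<lambda>i. ?g / sqrt (?S q (N i) / 4)) \<longlonglongrightarrow> 0"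
        by (intro tendsto_divide_0[OF tendsto_const] filterlim_at_top_imp_at_infinity) simp
    qed
  qed
  with compact_parametrices_domain[where f = "\<lambda>i. in_degree (int (p i)) (f i)",
      OF linear compact fD f_pos d_le]
  show False by blast
qed

text \<open>If the limit is not zero, \<open>\<beta>\<close> has finitely many zeros, so that the solutions on the adjoint side
  exist, and the growth bounds obtained from them supply doubling places: in a single degree with unbounded
  mass if there is one, otherwise one in each degree with the common constant 2.\<close>

lemma increments_tend_to_zero:
  assumes c_inc: "\<beta> \<in> c_inc"
  shows "lim (increment \<beta>) = 0"
proof (rule ccontr)
  assume lim: "lim (increment \<beta>) \<noteq> 0"
  obtain L where L: "0 \<le> L" "\<And>k. cmod (\<beta> k) \<le> L * real (k + 1)"
    using c_inc_linear_growth[OF c_inc] by blast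
  obtain m where m: "1 \<le> m" "\<And>k. m \<le> k \<Longrightarrow> \<beta> k \<noteq> 0"
    using c_inc_eventually_nonzero[OF c_inc lim] by blast
  obtain n where n: "1 \<le> n" and lower: "\<And>N. m \<le> N \<Longrightarrow> w (N + n) < w (m + n - 1) *
    (cmod (\<alpha> (N + n - 1) * recurrence_solution (\<lambda>j. \<alpha> (j + n - 1)) \<beta> m N))\<^sup>2"
    using adjoint_solution_lower_bound[OF m] by blast
  define M where "M = m + n - 1"
  have M: "1 \<le> M" using m n by (simp add: M_def)
  have \<alpha>: "\<alpha> j \<noteq> 0" if "M \<le> j" for j
  proof
    assume 0: "\<alpha> j = 0"
    define N where "N = j - (n - 1)"
    have N: "m \<le> N" "N + n - 1 = j" using that n by (auto simp: M_def N_def)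
    show False using lower[OF N(1)] w_pos[of "N + n"] unfolding N(2) 0 by simp
  qed
  let ?S = "solution_mass M"
  have pos: "0 < ?S p M" for p using solution_mass_lower[of M M p] w_pos[of M] by linarith
  show False
  proof (cases "\<exists>q. \<not> bdd_above (range (?S q))")
    case True
    then obtain q where q: "\<not> bdd_above (range (?S q))" ..
    obtain C e where growth: "\<And>N. ?S q N \<le> C * real (N + 1) ^ e"
      using solution_mass_polynomial_growth[OF L n m(2) _ lower, of q] \<alpha> unfolding M_def by blast
    have "\<exists>N. max i (max M q) \<le> N \<and> ?S q (2 * N) \<le> 2 ^ (e + 1) * ?S q N" for i
      using polynomial_growth_doubling[OF mono_solution_mass pos growth] by metis
    then obtain N where N: "\<And>i. max i (max M q) \<le> N i" "\<And>i. ?S q (2 * N i) \<le> 2 ^ (e + 1) * ?S q (N i)"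
      by metis
    have "filterlim (\<lambda>i. ?S q (N i)) at_top sequentially"
      unfolding filterlim_at_top
    proof
      fix Z
      obtain i0 where i0: "Z < ?S q i0" using q unfolding bdd_above_def by (auto simp: not_le)
      show "\<forall>\<^sub>F i in sequentially. Z \<le> ?S q (N i)"
        using eventually_ge_at_top[of i0]
      proof eventually_elim
        fix i assume "i0 \<le> i"
        then have "i0 \<le> N i" using N(1)[of i] by simp
        then have "?S q i0 \<le> ?S q (N i)" by (rule monoD[OF mono_solution_mass])
        with i0 show "Z \<le> ?S q (N i)" by linarith
      qed
    qed
    then show False
      by (intro no_doubling_sequence[OF L M \<alpha>, of N "\<lambda>_. q" "2 ^ (e + 1)"]) (use N in auto)
  next
    case False
    have "\<exists>N. max M p \<le> N \<and> ?S p (2 * N) \<le> 2 ^ (0 + 1) * ?S p N" for p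
    proof -
      obtain C where "\<And>N. ?S p N \<le> C"
        using False unfolding bdd_above_def by blast
      then have "?S p N \<le> C * real (N + 1) ^ 0" for N by simp
      from polynomial_growth_doubling[OF mono_solution_mass pos this] show ?thesis by metis
    qed
    then obtain N where N: "\<And>p. max M p \<le> N p" "\<And>p. ?S p (2 * N p) \<le> 2 ^ (0 + 1) * ?S p (N p)"
      by metis
    show False
      by (rule no_doubling_sequence[OF L M \<alpha>, of N "\<lambda>p. p" "2 ^ (0 + 1)"])
        (use N filterlim_ident in auto)
  qed
qed

end

theorem theorem7p4:
  fixes w :: "nat \<Rightarrow> real" and \<beta> \<alpha> :: "nat \<Rightarrow> complex"
  assumes "\<And>k. 0 < w k" and "w sums 1"
    and "\<beta> \<in> c_inc"
    and "summable (\<lambda>k. (cmod (\<beta> k - \<alpha> k))\<^sup>2 * w k)"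
    and "lim (increment \<beta>) \<noteq> 0"
  shows "\<not> (\<exists>D. closed_op (gns_weight w) D \<and> D_min \<beta> \<alpha> w \<subseteq> D \<and> D \<subseteq> D_max \<beta> \<alpha> w \<and>
            has_compact_parametrices (gns_weight w) D)"
proof
  assume "\<exists>D. closed_op (gns_weight w) D \<and> D_min \<beta> \<alpha> w \<subseteq> D \<and> D \<subseteq> D_max \<beta> \<alpha> w \<and>
            has_compact_parametrices (gns_weight w) D"
  then obtain D where "closed_op (gns_weight w) D" "D_min \<beta> \<alpha> w \<subseteq> D" "D \<subseteq> D_max \<beta> \<alpha> w"
    "has_compact_parametrices (gns_weight w) D" by blast
  then interpret compact_parametrices w \<beta> \<alpha> D by unfold_locales (use assms(1) in auto)
  show False using increments_tend_to_zero assms by simp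
qed

end
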